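(* Let $\mathcal{C}$ be a finite abstract simplicial complex, let $\mathcal{V}=\{V_1,\ldots,V_n\}$ be a partition of its vertex set $V(\mathcal{C})$, and let $\eta \in \{\eta_\pi,\eta_H\}$. If $\eta(\mathcal{C}[V_I]) \ge |I|+1$ for all nonempty $I \subseteq [n]$, where $V_I = \bigcup_{i\in I} V_i$, then the reconfiguration graph $\mathbf{RG}(\mathcal{C},\mathcal{V})$ is connected.
   Context: For a subset $X$ of the ground set, $\mathcal{C}[X]=\{\sigma\in\mathcal{C}:\sigma\subseteq X\}$. A complex is homotopically $k$-connected if for every $-1\le j\le k$ every continuous map $S^j\to\|\mathcal{C}\|$ extends to $B^{j+1}$ (being $(-1)$-connected means having nonempty geometric realization, i.e. at least one vertex). $\eta_\pi(\mathcal{C})$ is $2$ plus the largest $k\ge -2$ such that $\mathcal{C}$ is homotopically $j$-connected for all $j\le k$ (so $\eta_\pi=0$ if $\mathcal{C}$ has no vertices, and $\eta_\pi=\infty$ if it is $k$-connected for all $k$). $\eta_H(\mathcal{C})$ is $2$ plus the largest $k\ge-2$ such that the reduced simplicial homology $\widetilde H_j(\mathcal{C};\mathbb{Q})$ vanishes for all $-1\le j\le k$ (where $\widetilde H_{-1}=0$ means $\mathcal{C}$ has at least one vertex), possibly $\infty$. A colorful simplex of $(\mathcal{C},\mathcal{V})$ is a simplex of $\mathcal{C}$ containing exactly one vertex from each $V_i$. $\mathbf{RG}(\mathcal{C},\mathcal{V})$ has the colorful simplices as vertices, two being adjacent if their union is a simplex of $\mathcal{C}$ of size $n+1$. *)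

theory Defs
  imports "HOL-Analysis.Analysis" "HOL-Library.Extended_Nat"
begin

definition simplicial_complex :: "'v set set \<Rightarrow> bool" where
  "simplicial_complex C \<longleftrightarrow> finite C \<and> (\<forall>\<sigma>\<in>C. finite \<sigma>) \<and>
     (\<forall>\<sigma> \<tau>. \<sigma> \<in> C \<longrightarrow> \<tau> \<subseteq> \<sigma> \<longrightarrow> \<tau> \<in> C)"

definition vertices :: "'v set set \<Rightarrow> 'v set" where
  "vertices C = \<Union>C"

definition induced :: "'v set set \<Rightarrow> 'v set \<Rightarrow> 'v set set" where
  "induced C X = {\<sigma> \<in> C. \<sigma> \<subseteq> X}"

definition realization :: "'v set set \<Rightarrow> ('v \<Rightarrow> real) topology" where
  "realization C = subtopology (powertop_real UNIV)
     {f. (\<forall>v. 0 \<le> f v) \<and> {v. f v \<noteq> 0} \<in> C \<and> (\<Sum>v\<in>{v. f v \<noteq> 0}. f v) = 1}"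

text \<open>Closed unit ball B^{n+1} with boundary the library's sphere \<open>nsphere n\<close> = S^n.\<close>
definition nball :: "nat \<Rightarrow> (nat \<Rightarrow> real) topology" where
  "nball n = subtopology (Euclidean_space (Suc n)) {x. (\<Sum>i\<le>n. x i ^ 2) \<le> 1}"

definition htpy_conn_at :: "'v set set \<Rightarrow> int \<Rightarrow> bool" where
  "htpy_conn_at C j \<longleftrightarrow>
     (if j < 0 then topspace (realization C) \<noteq> {}
      else (\<forall>f. continuous_map (nsphere (nat j)) (realization C) f \<longrightarrow>
              (\<exists>g. continuous_map (nball (nat j)) (realization C) g \<and>
                   (\<forall>x\<in>topspace (nsphere (nat j)). g x = f x))))"

text \<open>eta_pi = 2 + largest k \<ge> -2 with j-connectivity for all -1 \<le> j \<le> k.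
  If d is the least natural number such that C is not (d-1)-connected,
  then k = d - 2 and eta_pi = d.\<close>
definition eta_pi :: "'v set set \<Rightarrow> enat" where
  "eta_pi C = (if \<forall>d::nat. htpy_conn_at C (int d - 1) then \<infinity>
               else enat (LEAST d::nat. \<not> htpy_conn_at C (int d - 1)))"

text \<open>Faces of the augmented chain complex: the simplices together with the empty
  simplex (which carries the augmentation, i.e. degree -1). A chain of degree d-1
  is a rational function on the faces of cardinality d. Orientation: each simplex
  is oriented by the linear order on vertices; the boundary of [v_0<...<v_d]
  is the sum of (-1)^i [v_0..(omit v_i)..v_d].\<close>

definition face :: "'v set set \<Rightarrow> 'v set \<Rightarrow> bool" where
  "face C \<sigma> \<longleftrightarrow> \<sigma> \<in> C \<or> \<sigma> = {}"

definition bd :: "'v::linorder set set \<Rightarrow> ('v set \<Rightarrow> rat) \<Rightarrow> 'v set \<Rightarrow> rat" where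
  "bd C c \<tau> = (\<Sum>\<sigma>\<in>{\<sigma>. face C \<sigma> \<and> \<tau> \<subseteq> \<sigma> \<and> card \<sigma> = Suc (card \<tau>)}.
       c \<sigma> * (-1) ^ card {w\<in>\<tau>. w < the_elem (\<sigma> - \<tau>)})"

text \<open>\<open>hom_vanish C d\<close>: the reduced homology group H~_{d-1}(C;Q) vanishes,
  i.e. every cycle on the faces of cardinality d is a boundary.\<close>
definition hom_vanish :: "'v::linorder set set \<Rightarrow> nat \<Rightarrow> bool" where
  "hom_vanish C d \<longleftrightarrow>
     (\<forall>c. (\<forall>\<tau>. face C \<tau> \<and> Suc (card \<tau>) = d \<longrightarrow> bd C c \<tau> = 0) \<longrightarrow>
          (\<exists>b. \<forall>\<tau>. face C \<tau> \<and> card \<tau> = d \<longrightarrow> c \<tau> = bd C b \<tau>))"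

definition eta_H :: "'v::linorder set set \<Rightarrow> enat" where
  "eta_H C = (if \<forall>d. hom_vanish C d then \<infinity>
              else enat (LEAST d. \<not> hom_vanish C d))"

definition is_partition :: "'v set \<Rightarrow> nat \<Rightarrow> (nat \<Rightarrow> 'v set) \<Rightarrow> bool" where
  "is_partition X n V \<longleftrightarrow> (\<forall>i\<in>{1..n}. V i \<noteq> {}) \<and>
     (\<forall>i\<in>{1..n}. \<forall>j\<in>{1..n}. i \<noteq> j \<longrightarrow> V i \<inter> V j = {}) \<and>
     (\<Union>i\<in>{1..n}. V i) = X"

definition colorful :: "'v set set \<Rightarrow> nat \<Rightarrow> (nat \<Rightarrow> 'v set) \<Rightarrow> 'v set \<Rightarrow> bool" where
  "colorful C n V \<sigma> \<longleftrightarrow> \<sigma> \<in> C \<and> (\<forall>i\<in>{1..n}. card (\<sigma> \<inter> V i) = 1)"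

definition RG_adj :: "'v set set \<Rightarrow> nat \<Rightarrow> (nat \<Rightarrow> 'v set) \<Rightarrow> 'v set \<Rightarrow> 'v set \<Rightarrow> bool" where
  "RG_adj C n V \<sigma> \<tau> \<longleftrightarrow> colorful C n V \<sigma> \<and> colorful C n V \<tau> \<and>
     \<sigma> \<union> \<tau> \<in> C \<and> card (\<sigma> \<union> \<tau>) = n + 1"

definition RG_connected :: "'v set set \<Rightarrow> nat \<Rightarrow> (nat \<Rightarrow> 'v set) \<Rightarrow> bool" where
  "RG_connected C n V \<longleftrightarrow>
     (\<forall>\<sigma> \<tau>. colorful C n V \<sigma> \<and> colorful C n V \<tau> \<longrightarrow> (RG_adj C n V)\<^sup>*\<^sup>* \<sigma> \<tau>)"

end

theory Submission
  imports Defs "HOL-Homology.Brouwer_Degree"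
begin

text \<open>Let \<open>\<sigma>\<close> and \<open>\<tau>\<close> be colourful simplices and \<open>\<Delta>\<close> the simplex with the colours as vertices. The
  connectivity hypothesis allows one to extend the two embeddings \<open>\<Delta> \<rightarrow> \<sigma>\<close> and \<open>\<Delta> \<rightarrow> \<tau>\<close> face by face to
  the prism over \<open>\<Delta>\<close>, in such a way that the prism over the face spanned by the colours \<open>I\<close> goes to
  the subcomplex of colours \<open>I\<close>.

  In homology this yields an \<open>n\<close>-chain whose boundary, restricted to colourful simplices, is
  \<open>\<tau> - \<sigma>\<close>, because the sides of the prism miss a colour. The total coefficient of such a boundary on
  each component of the reconfiguration graph is zero.

  In homotopy one composes with the colour map to \<open>\<Delta>\<close>. The points over the barycentre of \<open>\<Delta>\<close> are
  carried by colourful simplices, and if \<open>\<sigma>\<close> and \<open>\<tau>\<close> were in different components, a suitable height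
  function would turn the composite into a self-map of the prism that respects its faces and misses
  its centre, which is impossible as spheres are not contractible.\<close>

section \<open>Colour classes\<close>

locale partitioned_complex =
  fixes C :: "'v set set" and n :: nat and V :: "nat \<Rightarrow> 'v set"
  assumes complex: "simplicial_complex C"
    and partition: "is_partition (vertices C) n V"
begin

definition col :: "'v \<Rightarrow> nat" where
  "col v = (THE i. i \<in> {1..n} \<and> v \<in> V i)"

text \<open>The intersection with \<open>vertices C\<close> matters because \<open>col\<close> is
  unspecified outside the complex.\<close>

definition vertices_in :: "nat set \<Rightarrow> 'v set" where
  "vertices_in I = {v \<in> vertices C. col v \<in> I}"

lemma finite_simplex: "\<sigma> \<in> C \<Longrightarrow> finite \<sigma>"
  using complex by (auto simp: simplicial_complex_def)

lemma subset_simplex: "\<sigma> \<in> C \<Longrightarrow> \<tau> \<subseteq> \<sigma> \<Longrightarrow> \<tau> \<in> C"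
  using complex unfolding simplicial_complex_def by blast

lemma finite_complex: "finite C"
  using complex by (auto simp: simplicial_complex_def)

lemma finite_vertices: "finite (vertices C)"
  using complex by (auto simp: simplicial_complex_def vertices_def)

lemma simplex_subset_vertices: "\<sigma> \<in> C \<Longrightarrow> \<sigma> \<subseteq> vertices C"
  by (auto simp: vertices_def)

lemma col_eq:
  assumes "i \<in> {1..n}" "v \<in> V i" shows "col v = i"
  unfolding col_def
proof (rule the_equality)
  fix j assume j: "j \<in> {1..n} \<and> v \<in> V j"
  with assms have "V i \<inter> V j \<noteq> {}" by blast
  with j assms(1) partition show "j = i"
    unfolding is_partition_def by blast
qed (use assms in simp)

lemma col_vertex:
  assumes "v \<in> vertices C" shows "col v \<in> {1..n}" "v \<in> V (col v)"
proof -
  from assms partition obtain i where "i \<in> {1..n}" "v \<in> V i"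
    unfolding is_partition_def by blast
  with col_eq show "col v \<in> {1..n}" "v \<in> V (col v)" by auto
qed

lemma class_eq: "i \<in> {1..n} \<Longrightarrow> V i = {v \<in> vertices C. col v = i}"
  using col_eq col_vertex(2) partition by (auto simp: is_partition_def)

lemma Union_classes: "I \<subseteq> {1..n} \<Longrightarrow> (\<Union>i\<in>I. V i) = vertices_in I"
  using class_eq by (auto simp: vertices_in_def subset_eq)

text \<open>The classes cover the vertex set, so a simplex meeting each class exactly once has no
  further vertices, and \<open>col\<close> enumerates it.\<close>

lemma colorful_iff: "colorful C n V \<sigma> \<longleftrightarrow> \<sigma> \<in> C \<and> bij_betw col \<sigma> {1..n}"
proof (cases "\<sigma> \<in> C")
  case True
  have eq: "\<sigma> \<inter> V i = {v \<in> \<sigma>. col v = i}" if "i \<in> {1..n}" for i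
    using class_eq[OF that] simplex_subset_vertices[OF True] by blast
  have "(\<forall>i\<in>{1..n}. card (\<sigma> \<inter> V i) = 1) \<longleftrightarrow> (\<forall>i\<in>{1..n}. \<exists>v. {v \<in> \<sigma>. col v = i} = {v})"
    by (simp add: eq card_1_singleton_iff)
  also have "\<dots> \<longleftrightarrow> (\<forall>i\<in>{1..n}. \<exists>!v. v \<in> \<sigma> \<and> col v = i)"
    by (intro ball_cong refl) (simp only: Ex1_def set_eq_iff mem_Collect_eq singleton_iff, metis)
  also have "\<dots> \<longleftrightarrow> bij_betw col \<sigma> {1..n}"
  proof
    assume *: "\<forall>i\<in>{1..n}. \<exists>!v. v \<in> \<sigma> \<and> col v = i"
    have "col v \<in> {1..n}" if "v \<in> \<sigma>" for v
      using that col_vertex(1) simplex_subset_vertices[OF True] by blast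
    with * show "bij_betw col \<sigma> {1..n}"
      unfolding bij_betw_def inj_on_def by blast
  next
    assume *: "bij_betw col \<sigma> {1..n}"
    show "\<forall>i\<in>{1..n}. \<exists>!v. v \<in> \<sigma> \<and> col v = i"
    proof
      fix i assume "i \<in> {1..n}"
      then have "i \<in> col ` \<sigma>" using * by (simp add: bij_betw_def)
      then obtain v where "v \<in> \<sigma>" "col v = i" by auto
      with * show "\<exists>!v. v \<in> \<sigma> \<and> col v = i" by (auto simp: bij_betw_def inj_on_def)
    qed
  qed
  finally show ?thesis using True by (simp add: colorful_def)
qed (simp add: colorful_def)

lemma colorful_card: "colorful C n V \<sigma> \<Longrightarrow> card \<sigma> = n"
  unfolding colorful_iff using bij_betw_same_card by fastforce

text \<open>This is the elementary move along an edge of the graph: a vertex \<open>v\<close>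
  completing \<open>\<rho>\<close> to a larger simplex replaces the vertex of its own
  colour.\<close>

lemma colorful_swap:
  assumes \<rho>: "colorful C n V \<rho>" and v: "v \<notin> \<rho>" "insert v \<rho> \<in> C"
    and u: "u \<in> \<rho>" "col u = col v"
  shows "RG_adj C n V \<rho> (insert v (\<rho> - {u}))"
proof -
  have bij: "bij_betw col \<rho> {1..n}" using \<rho> by (simp add: colorful_iff)
  have inj: "inj_on col (insert v (\<rho> - {u}))"
    using bij u v by (auto simp: bij_betw_def inj_on_def)
  have "col ` insert v (\<rho> - {u}) = col ` insert u (\<rho> - {u})"
    using u(2) by (simp only: image_insert)
  then have "col ` insert v (\<rho> - {u}) = col ` \<rho>" using u(1) by (simp only: insert_Diff)
  with inj bij have "bij_betw col (insert v (\<rho> - {u})) {1..n}"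
    by (simp add: bij_betw_def)
  moreover have "insert v (\<rho> - {u}) \<in> C"
    using v(2) by (rule subset_simplex) auto
  moreover have "\<rho> \<union> insert v (\<rho> - {u}) = insert v \<rho>" by auto
  moreover have "card (insert v \<rho>) = n + 1"
    using colorful_card[OF \<rho>] v finite_simplex[OF v(2)] by simp
  ultimately show ?thesis
    using v \<rho> by (simp add: RG_adj_def colorful_iff)
qed

text \<open>Induction on the number of vertices of \<open>\<rho>'\<close> missing from
  \<open>\<rho>\<close>. One of them is swapped in; the vertex discarded has the same colour and so
  cannot belong to \<open>\<rho>'\<close>. All intermediate sets stay inside the simplex
  \<open>\<rho> \<union> \<rho>'\<close>.\<close>

lemma RG_reachable_in_simplex:
  assumes "colorful C n V \<rho>" "colorful C n V \<rho>'" "\<rho> \<union> \<rho>' \<in> C"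
  shows "(RG_adj C n V)\<^sup>*\<^sup>* \<rho> \<rho>'"
  using assms
proof (induction "card (\<rho>' - \<rho>)" arbitrary: \<rho>)
  case 0
  then have "\<rho>' \<subseteq> \<rho>" using finite_simplex[OF 0(4)] by auto
  moreover have "card \<rho>' = card \<rho>" using 0 colorful_card by metis
  ultimately have "\<rho>' = \<rho>"
    using finite_simplex[OF 0(4)] by (metis card_subset_eq finite_Un)
  then show ?case by simp
next
  case (Suc k)
  have fin: "finite \<rho>" "finite \<rho>'" using finite_simplex[OF Suc(5)] by auto
  from Suc(2) obtain v where v: "v \<in> \<rho>'" "v \<notin> \<rho>" by (metis Diff_iff card.empty ex_in_conv nat.distinct(1))
  have "col v \<in> col ` \<rho>"
    using Suc.prems v unfolding colorful_iff bij_betw_def by blast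
  then obtain u where u: "u \<in> \<rho>" "col u = col v" by auto
  have "u \<notin> \<rho>'"
    using u v Suc.prems unfolding colorful_iff bij_betw_def inj_on_def by metis
  have ins: "insert v \<rho> \<in> C" using Suc.prems(3) by (rule subset_simplex) (use v in auto)
  let ?\<rho> = "insert v (\<rho> - {u})"
  have adj: "RG_adj C n V \<rho> ?\<rho>" using colorful_swap[OF Suc.prems(1) v(2) ins u] .
  have "(RG_adj C n V)\<^sup>*\<^sup>* ?\<rho> \<rho>'"
  proof (rule Suc.hyps(1))
    have "\<rho>' - ?\<rho> = (\<rho>' - \<rho>) - {v}" using \<open>u \<notin> \<rho>'\<close> by auto
    then show "k = card (\<rho>' - ?\<rho>)" using Suc.hyps(2) v fin by simp
    show "colorful C n V ?\<rho>" using adj by (simp add: RG_adj_def)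
    show "?\<rho> \<union> \<rho>' \<in> C" using Suc.prems(3) by (rule subset_simplex) (use v in auto)
  qed (use Suc in simp)
  with adj show ?case by (rule converse_rtranclp_into_rtranclp)
qed

end

section \<open>Signs and boundaries with respect to an arbitrary vertex order\<close>

definition sign_at :: "('a \<Rightarrow> 'a \<Rightarrow> bool) \<Rightarrow> 'a \<Rightarrow> 'a set \<Rightarrow> rat" where
  "sign_at R v A = (- 1) ^ card {w \<in> A. R w v}"

text \<open>The sum runs over the vertex added to \<open>\<tau>\<close> and mentions no complex:
  chains are understood as extended by zero. The relation \<open>R\<close> is a parameter so that an
  order refining the colours can be used.\<close>

definition boundary :: "('v \<Rightarrow> 'v \<Rightarrow> bool) \<Rightarrow> 'v set \<Rightarrow> ('v set \<Rightarrow> rat) \<Rightarrow> 'v set \<Rightarrow> rat" where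
  "boundary R X c \<tau> = (\<Sum>v\<in>X - \<tau>. c (insert v \<tau>) * sign_at R v \<tau>)"

lemma sign_at_insert:
  assumes "finite A" "w \<notin> A"
  shows "sign_at R v (insert w A) = (if R w v then - sign_at R v A else sign_at R v A)"
proof -
  have "{x \<in> insert w A. R x v} = (if R w v then insert w {x \<in> A. R x v} else {x \<in> A. R x v})"
    by auto
  then show ?thesis using assms by (simp add: sign_at_def)
qed

text \<open>This is the identity that two successive boundaries give zero, on the faces of the
  simplex spanned by \<open>I\<close>. Deleting \<open>i\<close> and \<open>j\<close> in the two
  possible orders gives opposite signs, because deleting the smaller one shifts the position of the
  larger.\<close>

lemma alternating_double_sum_eq_0:
  fixes g :: "nat set \<Rightarrow> rat"
  assumes "finite I"
  shows "(\<Sum>i\<in>I. sign_at (<) i (I - {i}) * (\<Sum>j\<in>I - {i}. sign_at (<) j (I - {i} - {j}) * g (I - {i} - {j}))) = 0"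
    (is "?S = 0")
proof -
  let ?f = "\<lambda>i j. sign_at (<) i (I - {i}) * (sign_at (<) j (I - {i} - {j}) * g (I - {i} - {j}))"
  have anti: "?f i j = - ?f j i" if "i \<in> I" "j \<in> I" "i \<noteq> j" for i j
  proof -
    let ?A = "I - {i} - {j}"
    have eq: "I - {i} = insert j ?A" "I - {j} = insert i ?A" "I - {j} - {i} = ?A"
      using that by auto
    have fin: "finite ?A" using assms by simp
    have "sign_at (<) i (I - {i}) = (if j < i then - sign_at (<) i ?A else sign_at (<) i ?A)"
      by (subst eq(1), subst sign_at_insert[OF fin]) auto
    moreover have "sign_at (<) j (I - {j}) = (if i < j then - sign_at (<) j ?A else sign_at (<) j ?A)"
      by (subst eq(2), subst sign_at_insert[OF fin]) auto
    ultimately show ?thesis using that(3) eq(3) by auto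
  qed
  have "?S = (\<Sum>i\<in>I. \<Sum>j\<in>I - {i}. ?f i j)" by (simp add: sum_distrib_left)
  also have "\<dots> = (\<Sum>(i,j)\<in>(SIGMA i:I. I - {i}). ?f i j)"
    using assms by (simp add: sum.Sigma)
  also have "\<dots> = (\<Sum>(i,j)\<in>(SIGMA i:I. I - {i}). - ?f i j)"
    by (rule sum.reindex_bij_witness[of _ "\<lambda>(i,j). (j,i)" "\<lambda>(i,j). (j,i)"]) (auto intro!: anti[symmetric])
  also have "\<dots> = - (\<Sum>(i,j)\<in>(SIGMA i:I. I - {i}). ?f i j)"
    by (simp add: sum_negf case_prod_unfold)
  also have "\<dots> = - ?S" using assms by (simp add: sum.Sigma sum_distrib_left)
  finally show ?thesis by simp
qed

text \<open>For a total order \<open>R\<close> this is the sign of the permutation that rearranges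
  \<open>\<sigma>\<close> from the order \<open><\<close> to the order \<open>R\<close>: the
  exponent counts inversions.\<close>

definition order_change :: "('v::linorder \<Rightarrow> 'v \<Rightarrow> bool) \<Rightarrow> 'v set \<Rightarrow> rat" where
  "order_change R \<sigma> = (- 1) ^ card {(a, b). a \<in> \<sigma> \<and> b \<in> \<sigma> \<and> a < b \<and> R b a}"

lemma order_change_square: "order_change R \<sigma> * order_change R \<sigma> = 1"
  by (simp add: order_change_def flip: power_mult_distrib)

text \<open>Inserting \<open>v\<close> creates the inversions counted by \<open>?A\<close> and
  \<open>?B\<close>, while the elements preceding \<open>v\<close> are \<open>?A\<close> and
  \<open>?D\<close> for \<open><\<close>, and \<open>?B\<close> and \<open>?D\<close> for
  \<open>R\<close>. The exponents on the two sides therefore have the same parity.\<close>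

lemma order_change_insert:
  assumes fin: "finite \<tau>" and v: "v \<notin> \<tau>"
    and R: "\<And>a b. a \<noteq> b \<Longrightarrow> R a b \<longleftrightarrow> \<not> R b a"
  shows "order_change R (insert v \<tau>) * sign_at (<) v \<tau> = order_change R \<tau> * sign_at R v \<tau>"
proof -
  let ?P = "{(a, b). a \<in> \<tau> \<and> b \<in> \<tau> \<and> a < b \<and> R b a}"
  let ?A = "{a \<in> \<tau>. a < v \<and> R v a}" and ?B = "{b \<in> \<tau>. v < b \<and> R b v}"
    and ?D = "{a \<in> \<tau>. a < v \<and> R a v}"
  have finP: "finite ?P" by (rule finite_subset[of _ "\<tau> \<times> \<tau>"]) (use fin in auto)
  have "{(a, b). a \<in> insert v \<tau> \<and> b \<in> insert v \<tau> \<and> a < b \<and> R b a} =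
      ?P \<union> ((\<lambda>a. (a, v)) ` ?A \<union> (\<lambda>b. (v, b)) ` ?B)" using v by auto
  moreover have "card (?P \<union> ((\<lambda>a. (a, v)) ` ?A \<union> (\<lambda>b. (v, b)) ` ?B)) = card ?P + (card ?A + card ?B)"
    using fin finP v
    by (subst card_Un_disjoint, (auto)[3], subst card_Un_disjoint) (auto simp: card_image inj_on_def)
  ultimately have 1: "card {(a, b). a \<in> insert v \<tau> \<and> b \<in> insert v \<tau> \<and> a < b \<and> R b a} =
      card ?P + (card ?A + card ?B)" by simp
  have Rv: "R v a \<longleftrightarrow> \<not> R a v" if "a \<in> \<tau>" for a
    using that v R by metis
  have "{w \<in> \<tau>. w < v} = ?A \<union> ?D"
    using Rv by auto
  note split_less = this
  have 2: "card {w \<in> \<tau>. w < v} = card ?A + card ?D"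
    unfolding split_less by (rule card_Un_disjoint) (use fin Rv in auto)
  have "{w \<in> \<tau>. R w v} = ?B \<union> ?D"
    using v by (auto simp: not_less_iff_gr_or_eq)
  note split_R = this
  have "?B \<inter> ?D = {}" using less_asym by blast
  with fin have 3: "card {w \<in> \<tau>. R w v} = card ?B + card ?D"
    unfolding split_R by (simp add: card_Un_disjoint)
  show ?thesis
    unfolding order_change_def sign_at_def 1 2 3
    by (auto simp: minus_one_power_iff)
qed

section \<open>Comparison of the boundary operators for different vertex orders\<close>

context
  fixes K :: "'v::linorder set set" and X :: "'v set"
  assumes K_finite: "finite X" and K_vertices: "\<And>\<sigma>. \<sigma> \<in> K \<Longrightarrow> \<sigma> \<subseteq> X" and K_empty: "{} \<in> K"
begin

text \<open>A face containing \<open>\<tau>\<close> with one more element corresponds to its extra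
  vertex. Since \<open>{} \<in> K\<close>, the predicate \<open>face K\<close> is just membership in
  \<open>K\<close>.\<close>

lemma bd_eq_boundary:
  assumes "finite \<tau>"
  shows "bd K c \<tau> = boundary (<) X (\<lambda>\<sigma>. if \<sigma> \<in> K then c \<sigma> else 0) \<tau>"
proof -
  have "boundary (<) X (\<lambda>\<sigma>. if \<sigma> \<in> K then c \<sigma> else 0) \<tau> =
      (\<Sum>v\<in>{v \<in> X - \<tau>. insert v \<tau> \<in> K}. c (insert v \<tau>) * sign_at (<) v \<tau>)"
    unfolding boundary_def
    by (rule sum.mono_neutral_cong_right) (use K_finite in auto)
  also have "\<dots> = bd K c \<tau>"
    unfolding bd_def
  proof (rule sum.reindex_bij_witness[of _ "\<lambda>\<sigma>. the_elem (\<sigma> - \<tau>)" "\<lambda>v. insert v \<tau>"])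
    fix v assume "v \<in> {v \<in> X - \<tau>. insert v \<tau> \<in> K}"
    then have v: "v \<notin> \<tau>" "insert v \<tau> \<in> K" by auto
    then have d: "insert v \<tau> - \<tau> = {v}" by auto
    show "the_elem (insert v \<tau> - \<tau>) = v" by (simp add: d)
    show "insert v \<tau> \<in> {\<sigma>. face K \<sigma> \<and> \<tau> \<subseteq> \<sigma> \<and> card \<sigma> = Suc (card \<tau>)}"
      using v assms by (auto simp: face_def)
    show "c (insert v \<tau>) * (- 1) ^ card {w \<in> \<tau>. w < the_elem (insert v \<tau> - \<tau>)} =
        c (insert v \<tau>) * sign_at (<) v \<tau>" by (simp add: d sign_at_def)
  next
    fix \<sigma> assume "\<sigma> \<in> {\<sigma>. face K \<sigma> \<and> \<tau> \<subseteq> \<sigma> \<and> card \<sigma> = Suc (card \<tau>)}"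
    then have \<sigma>: "\<sigma> \<in> K" "\<tau> \<subseteq> \<sigma>" "card \<sigma> = Suc (card \<tau>)" using K_empty by (auto simp: face_def)
    then have "card (\<sigma> - \<tau>) = 1" using assms by (simp add: card_Diff_subset)
    then obtain v where v: "\<sigma> - \<tau> = {v}" by (auto simp: card_1_singleton_iff)
    then have *: "insert v \<tau> = \<sigma>" using \<sigma>(2) by auto
    show "insert (the_elem (\<sigma> - \<tau>)) \<tau> = \<sigma>" by (simp add: v *)
    have "v \<in> X - \<tau>" using v K_vertices[OF \<sigma>(1)] by auto
    with v * \<sigma>(1) show "the_elem (\<sigma> - \<tau>) \<in> {v \<in> X - \<tau>. insert v \<tau> \<in> K}" by simp
  qed
  finally show ?thesis ..
qed

text \<open>By \<open>order_change_insert\<close>, multiplication by the reordering sign is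
  compatible with the boundaries term by term, so it is a chain isomorphism between the two
  orientations.\<close>

lemma bd_order_change:
  assumes fin: "finite \<tau>" and c: "\<And>\<sigma>. c \<sigma> \<noteq> 0 \<Longrightarrow> \<sigma> \<in> K"
    and R: "\<And>a b. a \<noteq> b \<Longrightarrow> R a b \<longleftrightarrow> \<not> R b a"
  shows "bd K (\<lambda>\<sigma>. order_change R \<sigma> * c \<sigma>) \<tau> = order_change R \<tau> * boundary R X c \<tau>"
proof -
  have *: "(if \<sigma> \<in> K then order_change R \<sigma> * c \<sigma> else 0) = order_change R \<sigma> * c \<sigma>" for \<sigma>
    using c by auto
  have "order_change R (insert v \<tau>) * c (insert v \<tau>) * sign_at (<) v \<tau> =
        order_change R \<tau> * (c (insert v \<tau>) * sign_at R v \<tau>)" if "v \<in> X - \<tau>" for v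
  proof -
    have "order_change R (insert v \<tau>) * c (insert v \<tau>) * sign_at (<) v \<tau> =
        (order_change R (insert v \<tau>) * sign_at (<) v \<tau>) * c (insert v \<tau>)" by simp
    also have "\<dots> = (order_change R \<tau> * sign_at R v \<tau>) * c (insert v \<tau>)"
      using that by (subst order_change_insert[OF fin _ R]) auto
    finally show ?thesis by simp
  qed
  then show ?thesis
    unfolding bd_eq_boundary[OF fin] * boundary_def sum_distrib_left
    by (rule sum.cong[OF refl])
qed

text \<open>The cycle is transported to the orientation by \<open><\<close>, filled there, and the
  filling is transported back. Cutting it off outside \<open>K\<close> makes the boundary equation
  valid at all finite sets, not only at faces.\<close>

lemma hom_vanish_fill:
  assumes down: "\<And>\<sigma> \<tau>. \<sigma> \<in> K \<Longrightarrow> \<tau> \<subseteq> \<sigma> \<Longrightarrow> \<tau> \<in> K"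
    and vanish: "hom_vanish K d"
    and R: "\<And>a b. a \<noteq> b \<Longrightarrow> R a b \<longleftrightarrow> \<not> R b a"
    and c: "\<And>\<sigma>. c \<sigma> \<noteq> 0 \<Longrightarrow> \<sigma> \<in> K \<and> card \<sigma> = d"
    and cycle: "\<And>\<tau>. \<tau> \<in> K \<Longrightarrow> boundary R X c \<tau> = 0"
  shows "\<exists>b. (\<forall>\<sigma>. b \<sigma> \<noteq> 0 \<longrightarrow> \<sigma> \<in> K \<and> card \<sigma> = Suc d) \<and>
    (\<forall>\<tau>. finite \<tau> \<longrightarrow> boundary R X b \<tau> = c \<tau>)"
proof -
  have K_fin: "finite \<sigma>" if "\<sigma> \<in> K" for \<sigma> using that K_finite K_vertices finite_subset by blast
  let ?c = "\<lambda>\<sigma>. order_change R \<sigma> * c \<sigma>"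
  have "\<forall>\<tau>. face K \<tau> \<and> Suc (card \<tau>) = d \<longrightarrow> bd K ?c \<tau> = 0"
  proof (intro allI impI, elim conjE)
    fix \<tau> assume "face K \<tau>"
    then have "\<tau> \<in> K" using K_empty by (auto simp: face_def)
    then show "bd K ?c \<tau> = 0" using bd_order_change[OF K_fin _ R, of \<tau> c] c cycle by simp
  qed
  with vanish[unfolded hom_vanish_def, THEN spec, THEN mp]
  have "\<exists>b'. \<forall>\<tau>. face K \<tau> \<and> card \<tau> = d \<longrightarrow> ?c \<tau> = bd K b' \<tau>" .
  then obtain b' where b': "\<forall>\<tau>. face K \<tau> \<and> card \<tau> = d \<longrightarrow> ?c \<tau> = bd K b' \<tau>"
    by (rule exE)
  \<comment> \<open>Nothing is known about \<open>b'\<close> except on faces of cardinality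
    \<open>Suc d\<close>, hence the cut-off.\<close>
  define b where "b \<sigma> = (if \<sigma> \<in> K \<and> card \<sigma> = Suc d then order_change R \<sigma> * b' \<sigma> else 0)" for \<sigma>
  have b: "\<sigma> \<in> K \<and> card \<sigma> = Suc d" if "b \<sigma> \<noteq> 0" for \<sigma>
  proof (rule ccontr)
    assume "\<not> ?thesis"
    then have "b \<sigma> = 0" by (simp only: b_def if_False)
    with that show False by contradiction
  qed
  have "boundary R X b \<tau> = c \<tau>" if fin: "finite \<tau>" for \<tau>
  proof (cases "\<tau> \<in> K \<and> card \<tau> = d")
    case True
    have "order_change R \<tau> * boundary R X b \<tau> = bd K (\<lambda>\<sigma>. order_change R \<sigma> * b \<sigma>) \<tau>"
      using bd_order_change[OF fin _ R, of b] b by simp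
    also have "\<dots> = bd K b' \<tau>"
      unfolding bd_def
      by (rule sum.cong) (use True K_empty in \<open>auto simp: b_def face_def mult.assoc[symmetric] order_change_square\<close>)
    also have "\<dots> = order_change R \<tau> * c \<tau>"
      using b'[THEN spec, of \<tau>] True by (simp add: face_def)
    finally show ?thesis by (metis mult.assoc mult_1 order_change_square)
  next
    case False
    \<comment> \<open>A face of cardinality \<open>Suc d\<close> containing \<open>\<tau>\<close> as
      a facet would make \<open>\<tau>\<close> a face of cardinality \<open>d\<close>.\<close>
    have "b (insert v \<tau>) = 0" if "v \<notin> \<tau>" for v
    proof (rule ccontr)
      assume "b (insert v \<tau>) \<noteq> 0"
      then have "insert v \<tau> \<in> K" "card (insert v \<tau>) = Suc d" using b by auto
      then show False using False that fin down[of "insert v \<tau>" \<tau>] by auto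
    qed
    then have "boundary R X b \<tau> = 0" by (simp add: boundary_def)
    moreover have "c \<tau> = 0" using c[of \<tau>] False by auto
    ultimately show ?thesis by simp
  qed
  with b show ?thesis by blast
qed

end

section \<open>Rational homology\<close>

locale ordered_partitioned_complex = partitioned_complex C n V
  for C :: "'v::linorder set set" and n :: nat and V :: "nat \<Rightarrow> 'v set"
begin

text \<open>Homology does not depend on the vertex order. With an order refining the colours, the sign of a
  vertex in a partially colourful simplex depends on the colours alone.\<close>

definition col_less :: "'v \<Rightarrow> 'v \<Rightarrow> bool" where
  "col_less u v \<longleftrightarrow> col u < col v \<or> (col u = col v \<and> u < v)"

lemma col_less_total: "u \<noteq> v \<Longrightarrow> col_less u v \<longleftrightarrow> \<not> col_less v u"
  by (auto simp: col_less_def)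

abbreviation "bdy \<equiv> boundary col_less (vertices C)"

section \<open>Parts of colourful simplices as images of colour sets\<close>

definition part :: "'v set \<Rightarrow> nat set \<Rightarrow> 'v set" where
  "part \<sigma> I = {v \<in> \<sigma>. col v \<in> I}"

lemma part_bij:
  assumes "colorful C n V \<sigma>" "I \<subseteq> {1..n}"
  shows "bij_betw col (part \<sigma> I) I"
proof -
  have inj: "inj_on col \<sigma>" and img: "col ` \<sigma> = {1..n}"
    using assms(1) by (auto simp: colorful_iff bij_betw_def)
  have "I \<subseteq> col ` part \<sigma> I"
  proof
    fix i assume i: "i \<in> I"
    with assms(2) img have "i \<in> col ` \<sigma>" by blast
    with i show "i \<in> col ` part \<sigma> I" by (auto simp: part_def)
  qed
  moreover have "col ` part \<sigma> I \<subseteq> I" by (auto simp: part_def)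
  moreover have "inj_on col (part \<sigma> I)"
    using inj by (rule inj_on_subset) (auto simp: part_def)
  ultimately show ?thesis by (simp add: bij_betw_def)
qed

lemma part_remove:
  assumes "colorful C n V \<sigma>" "I \<subseteq> {1..n}" "v \<in> part \<sigma> I"
  shows "part \<sigma> (I - {col v}) = part \<sigma> I - {v}"
  using part_bij[OF assms(1,2)] assms(3) by (auto simp: part_def bij_betw_def inj_on_def)

lemma sign_at_part:
  assumes "colorful C n V \<sigma>" "I \<subseteq> {1..n}" "v \<in> part \<sigma> I"
  shows "sign_at col_less v (part \<sigma> I - {v}) = sign_at (<) (col v) (I - {col v})"
proof -
  have inj: "inj_on col (part \<sigma> I)" and img: "col ` part \<sigma> I = I"
    using part_bij[OF assms(1,2)] by (auto simp: bij_betw_def)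
  have "bij_betw col {w \<in> part \<sigma> I - {v}. col_less w v} {j \<in> I - {col v}. j < col v}"
    unfolding bij_betw_def
  proof
    show "inj_on col {w \<in> part \<sigma> I - {v}. col_less w v}"
      using inj by (rule inj_on_subset) auto
    have "col w \<noteq> col v" if "w \<in> part \<sigma> I - {v}" for w
      using inj that assms(3) by (auto simp: inj_on_def)
    then have "{w \<in> part \<sigma> I - {v}. col_less w v} = {w \<in> part \<sigma> I. col w < col v}"
      by (auto simp: col_less_def)
    moreover have "col ` {w \<in> part \<sigma> I. col w < col v} = {j \<in> col ` part \<sigma> I. j < col v}"
      by auto
    ultimately show "col ` {w \<in> part \<sigma> I - {v}. col_less w v} = {j \<in> I - {col v}. j < col v}"
      using img by auto
  qed
  then show ?thesis by (simp add: sign_at_def bij_betw_same_card)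
qed

text \<open>The facets of \<open>part \<sigma> I\<close> are indexed by the deleted colour, with the
  sign this colour has in \<open>I\<close>. Thus \<open>I \<mapsto> part \<sigma> I\<close> is a
  chain map from the simplex of colours.\<close>

lemma boundary_indicator_part:
  assumes \<sigma>: "colorful C n V \<sigma>" and I: "I \<subseteq> {1..n}"
  shows "bdy (\<lambda>\<rho>. of_bool (\<rho> = part \<sigma> I)) \<tau> =
    (\<Sum>i\<in>I. sign_at (<) i (I - {i}) * of_bool (\<tau> = part \<sigma> (I - {i})))"
proof -
  let ?P = "part \<sigma> I"
  have sub: "?P \<subseteq> vertices C"
    using \<sigma> simplex_subset_vertices by (auto simp: part_def colorful_iff)
  have "bdy (\<lambda>\<rho>. of_bool (\<rho> = ?P)) \<tau> =
      (\<Sum>v\<in>?P. sign_at (<) (col v) (I - {col v}) * of_bool (\<tau> = part \<sigma> (I - {col v})))"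
    unfolding boundary_def
  proof (rule sum.mono_neutral_cong)
    fix v assume "v \<in> (vertices C - \<tau>) \<inter> ?P"
    then have v: "v \<notin> \<tau>" "v \<in> ?P" by auto
    then have "insert v \<tau> = ?P \<longleftrightarrow> \<tau> = ?P - {v}" by auto
    then show "of_bool (insert v \<tau> = ?P) * sign_at col_less v \<tau> =
        sign_at (<) (col v) (I - {col v}) * of_bool (\<tau> = part \<sigma> (I - {col v}))"
      using v sign_at_part[OF \<sigma> I v(2)] part_remove[OF \<sigma> I v(2)] by auto
  next
    fix v assume "v \<in> ?P - (vertices C - \<tau>)"
    then have "v \<in> ?P" "v \<in> \<tau>" using sub by auto
    then show "sign_at (<) (col v) (I - {col v}) * of_bool (\<tau> = part \<sigma> (I - {col v})) = 0"
      using part_remove[OF \<sigma> I] by auto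
  qed (use finite_vertices sub finite_subset in auto)
  also have "\<dots> = (\<Sum>i\<in>I. sign_at (<) i (I - {i}) * of_bool (\<tau> = part \<sigma> (I - {i})))"
    by (rule sum.reindex_bij_betw[OF part_bij[OF \<sigma> I]])
  finally show ?thesis .
qed

lemma boundary_sum:
  "bdy (\<lambda>\<rho>. \<Sum>i\<in>I. a i * f i \<rho>) \<tau> = (\<Sum>i\<in>I. a i * bdy (f i) \<tau>)"
proof -
  have "bdy (\<lambda>\<rho>. \<Sum>i\<in>I. a i * f i \<rho>) \<tau> =
      (\<Sum>v\<in>vertices C - \<tau>. \<Sum>i\<in>I. a i * (f i (insert v \<tau>) * sign_at col_less v \<tau>))"
    by (simp add: boundary_def sum_distrib_right mult.assoc)
  also have "\<dots> = (\<Sum>i\<in>I. a i * bdy (f i) \<tau>)"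
    by (subst sum.swap) (simp add: boundary_def sum_distrib_left)
  finally show ?thesis .
qed

lemma boundary_diff: "bdy (\<lambda>\<rho>. f \<rho> - g \<rho>) \<tau> = bdy f \<tau> - bdy g \<tau>"
  by (simp add: boundary_def left_diff_distrib sum_subtractf)

definition prism_ends :: "'v set \<Rightarrow> 'v set \<Rightarrow> nat set \<Rightarrow> 'v set \<Rightarrow> rat" where
  "prism_ends \<sigma> \<tau> I \<rho> = of_bool (\<rho> = part \<tau> I) - of_bool (\<rho> = part \<sigma> I)"

text \<open>This is \<open>h\<close> applied to the boundary of the face \<open>I\<close>. The
  equation \<open>bdy (h I) = prism_ends - prism_sides\<close> then says that \<open>h\<close> is a
  chain homotopy between the chain maps given by \<open>\<sigma>\<close> and
  \<open>\<tau>\<close>.\<close>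

definition prism_sides :: "(nat set \<Rightarrow> 'v set \<Rightarrow> rat) \<Rightarrow> nat set \<Rightarrow> 'v set \<Rightarrow> rat" where
  "prism_sides h I \<rho> = (\<Sum>i\<in>I. sign_at (<) i (I - {i}) * h (I - {i}) \<rho>)"

text \<open>The chain \<open>h I\<close> plays the role of the prism over the face of the simplex spanned by \<open>I\<close>,
  mapped to the subcomplex of colours \<open>I\<close>, running from the part of \<open>\<sigma>\<close> to the part of \<open>\<tau>\<close>.\<close>

lemma prism_chains:
  assumes hom: "\<And>I. I \<subseteq> {1..n} \<Longrightarrow> I \<noteq> {} \<Longrightarrow> hom_vanish (induced C (vertices_in I)) (card I)"
    and \<sigma>: "colorful C n V \<sigma>" and \<tau>: "colorful C n V \<tau>"
  shows "\<exists>h. \<forall>I. I \<subseteq> {1..n} \<longrightarrow> card I \<le> k \<longrightarrow>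
    (\<forall>\<rho>. h I \<rho> \<noteq> 0 \<longrightarrow> \<rho> \<in> C \<and> \<rho> \<subseteq> vertices_in I \<and> card \<rho> = Suc (card I)) \<and>
    (\<forall>\<rho>. finite \<rho> \<longrightarrow> bdy (h I) \<rho> = prism_ends \<sigma> \<tau> I \<rho> - prism_sides h I \<rho>)"
    (is "\<exists>h. \<forall>I. I \<subseteq> _ \<longrightarrow> card I \<le> k \<longrightarrow> ?supp (h I) I \<and> ?bd h (h I) I")
proof (induction k)
  case 0
  show ?case
  \<comment> \<open>Only \<open>I = {}\<close> occurs here. Both parts are then empty and the two
    ends cancel, so the zero chain is a filling.\<close>
  proof (intro exI[of _ "\<lambda>_ _. 0"] allI impI)
    fix I :: "nat set" assume "I \<subseteq> {1..n}" "card I \<le> 0"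
    then have "I = {}" using finite_subset by fastforce
    then show "?supp (\<lambda>_. 0) I \<and> ?bd (\<lambda>_ _. 0) (\<lambda>_. 0) I"
      by (simp add: boundary_def prism_ends_def prism_sides_def part_def)
  qed
next
  case (Suc k)
  obtain h where "\<forall>I. I \<subseteq> {1..n} \<longrightarrow> card I \<le> k \<longrightarrow> ?supp (h I) I \<and> ?bd h (h I) I"
    using Suc by (rule exE)
  note h_all = this[rule_format]
    and h = this[rule_format, THEN conjunct1, rule_format] this[rule_format, THEN conjunct2, rule_format]
  have ex: "\<exists>b. ?supp b I \<and> ?bd h b I" if I: "I \<subseteq> {1..n}" and card_I: "card I = Suc k" for I
  proof -
    let ?K = "induced C (vertices_in I)"
    let ?c = "\<lambda>\<rho>. prism_ends \<sigma> \<tau> I \<rho> - prism_sides h I \<rho>"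
    have fin_I: "finite I" using I finite_subset by blast
    have sub: "I - {i} \<subseteq> {1..n}" "card (I - {i}) = k" if "i \<in> I" for i
      using that I card_I fin_I by auto
    have K: "\<rho> \<in> ?K \<longleftrightarrow> \<rho> \<in> C \<and> \<rho> \<subseteq> vertices_in I" for \<rho> by (simp add: induced_def)
    have part_K: "part \<rho> I \<in> ?K \<and> card (part \<rho> I) = card I" if "colorful C n V \<rho>" for \<rho>
    proof -
      have "\<rho> \<in> C" using that by (simp add: colorful_iff)
      then have "part \<rho> I \<in> C" by (rule subset_simplex) (auto simp: part_def)
      moreover have "part \<rho> I \<subseteq> vertices_in I"
        using simplex_subset_vertices[OF \<open>\<rho> \<in> C\<close>] by (auto simp: part_def vertices_in_def)
      ultimately show ?thesis using part_bij[OF that I] bij_betw_same_card K by blast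
    qed
    \<comment> \<open>Ends and sides both live on faces with \<open>card I\<close> vertices, the
      degree in which \<open>hom\<close> provides a filling.\<close>
    have c: "\<rho> \<in> ?K \<and> card \<rho> = card I" if "?c \<rho> \<noteq> 0" for \<rho>
    proof (cases "prism_sides h I \<rho> = 0")
      case True
      with that have "\<rho> = part \<tau> I \<or> \<rho> = part \<sigma> I" by (simp add: prism_ends_def of_bool_def split: if_splits)
      with part_K[OF \<sigma>] part_K[OF \<tau>] show ?thesis by (elim disjE) simp_all
    next
      case False
      have "\<exists>i\<in>I. h (I - {i}) \<rho> \<noteq> 0"
      proof (rule ccontr)
        assume "\<not> ?thesis"
        then have "prism_sides h I \<rho> = 0" by (simp add: prism_sides_def)
        with False show False by simp
      qed
      then obtain i where i: "i \<in> I" "h (I - {i}) \<rho> \<noteq> 0" by (elim bexE)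
      then have "\<rho> \<in> C" "\<rho> \<subseteq> vertices_in (I - {i})" "card \<rho> = Suc k"
        using h(1)[of "I - {i}" \<rho>] sub[OF i(1)] by auto
      moreover have "vertices_in (I - {i}) \<subseteq> vertices_in I" by (auto simp: vertices_in_def)
      ultimately show ?thesis using K card_I by (metis order_trans)
    qed
    \<comment> \<open>The boundary of the ends is the signed sum of the ends over the sets
      \<open>I - {i}\<close>. The induction hypothesis gives the same sum for the sides, up to a
      double sum over sides that cancels.\<close>
    have cycle: "bdy ?c \<rho> = 0" if "\<rho> \<in> ?K" for \<rho>
    proof -
      have fin: "finite \<rho>" using that K finite_simplex by blast
      have "bdy (prism_ends \<sigma> \<tau> I) \<rho> = (\<Sum>i\<in>I. sign_at (<) i (I - {i}) * prism_ends \<sigma> \<tau> (I - {i}) \<rho>)"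
        unfolding prism_ends_def boundary_diff boundary_indicator_part[OF \<sigma> I] boundary_indicator_part[OF \<tau> I]
        by (simp add: right_diff_distrib sum_subtractf)
      moreover have "bdy (prism_sides h I) \<rho> = (\<Sum>i\<in>I. sign_at (<) i (I - {i}) * bdy (h (I - {i})) \<rho>)"
        unfolding prism_sides_def by (rule boundary_sum)
      moreover have "\<dots> = (\<Sum>i\<in>I. sign_at (<) i (I - {i}) *
          (prism_ends \<sigma> \<tau> (I - {i}) \<rho> - prism_sides h (I - {i}) \<rho>))"
        by (rule sum.cong) (use h(2) sub fin in auto)
      moreover have "(\<Sum>i\<in>I. sign_at (<) i (I - {i}) * prism_sides h (I - {i}) \<rho>) = 0"
        unfolding prism_sides_def by (rule alternating_double_sum_eq_0[OF fin_I])
      ultimately show ?thesis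
        by (simp add: boundary_diff right_diff_distrib sum_subtractf)
    qed
    have K_vertices: "\<rho> \<subseteq> vertices C" if "\<rho> \<in> ?K" for \<rho>
      using that K simplex_subset_vertices by blast
    have "\<sigma> \<in> C" using \<sigma> by (simp add: colorful_iff)
    then have K_empty: "{} \<in> ?K" using subset_simplex K by blast
    have "I \<noteq> {}" using card_I by auto
    have down: "\<rho>' \<in> ?K" if "\<rho> \<in> ?K" "\<rho>' \<subseteq> \<rho>" for \<rho> \<rho>'
      using that subset_simplex[of \<rho> \<rho>'] by (auto simp: K)
    have "\<exists>b. (\<forall>\<rho>. b \<rho> \<noteq> 0 \<longrightarrow> \<rho> \<in> ?K \<and> card \<rho> = Suc (card I)) \<and>
        (\<forall>\<rho>. finite \<rho> \<longrightarrow> bdy b \<rho> = ?c \<rho>)"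
      by (rule hom_vanish_fill)
        (fact finite_vertices K_vertices K_empty down hom[OF I \<open>I \<noteq> {}\<close>] col_less_total c cycle)+
    then show ?thesis by (simp only: K conj_assoc)
  qed
  \<comment> \<open>Fillings are chosen simultaneously for all \<open>I\<close> with
    \<open>Suc k\<close> colours. The sides of such an \<open>I\<close> involve only smaller sets,
    where \<open>g\<close> is still \<open>h\<close>.\<close>
  define g where "g I = (if card I \<le> k then h I else SOME b. ?supp b I \<and> ?bd h b I)" for I
  show ?case
  proof (intro exI[of _ g] allI impI)
    fix I assume I: "I \<subseteq> {1..n}" "card I \<le> Suc k"
    have fin_I: "finite I" using I finite_subset by blast
    have "card (I - {i}) \<le> k" if "i \<in> I" for i using that I(2) fin_I by simp
    then have "prism_sides g I = prism_sides h I"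
      unfolding prism_sides_def by (intro ext sum.cong) (auto simp: g_def)
    moreover have "?supp (g I) I \<and> ?bd h (g I) I"
    proof (cases "card I \<le> k")
      case True
      then have "g I = h I" by (simp add: g_def)
      with h_all[OF I(1) True] show ?thesis by (simp only:)
    next
      case False
      then have "card I = Suc k" using I(2) by simp
      have "g I = (SOME b. ?supp b I \<and> ?bd h b I)" using False by (simp add: g_def)
      then show ?thesis
        by (rule forw_subst) (rule someI_ex[OF ex[OF I(1) \<open>card I = Suc k\<close>]])
    qed
    ultimately show "?supp (g I) I \<and> ?bd g (g I) I" by (simp only:)
  qed
qed

text \<open>A simplex with \<open>n + 1\<close> vertices has either no colourful facet or exactly two, which lie
  in the same component of the reconfiguration graph and, as the order refines the colour
  order, appear with opposite signs.\<close>

lemma sum_boundary_component: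
  assumes K: "\<And>\<rho>. \<rho> \<in> K \<Longrightarrow> colorful C n V \<rho>"
    and closed: "\<And>\<rho> \<rho>'. \<rho> \<in> K \<Longrightarrow> RG_adj C n V \<rho> \<rho>' \<Longrightarrow> \<rho>' \<in> K"
    and h: "\<And>\<rho>. h \<rho> \<noteq> 0 \<Longrightarrow> \<rho> \<in> C"
  shows "(\<Sum>\<rho>\<in>K. bdy h \<rho>) = 0"
proof -
  have "K \<subseteq> C" using K by (auto simp: colorful_iff)
  then have fin_K: "finite K" using finite_complex finite_subset by blast
  \<comment> \<open>\<open>S\<close> consists of a colourful simplex of \<open>K\<close> together
    with a vertex completing it to a larger simplex. The involution \<open>swap\<close> passes to
    the other colourful facet of that larger simplex and negates the term \<open>f\<close> of the
    boundary sum.\<close>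
  define S where "S = (SIGMA \<rho>:K. {v \<in> vertices C - \<rho>. insert v \<rho> \<in> C})"
  define mate where "mate \<rho> v = (THE u. u \<in> \<rho> \<and> col u = col v)" for \<rho> v
  define swap where "swap = (\<lambda>(\<rho>, v). (insert v (\<rho> - {mate \<rho> v}), mate \<rho> v))"
  define f where "f = (\<lambda>(\<rho>, v). h (insert v \<rho>) * sign_at col_less v \<rho>)"
  have mate: "mate \<rho> v = u" if "\<rho> \<in> K" "u \<in> \<rho>" "col u = col v" for \<rho> u v
    unfolding mate_def
    by (rule the_equality) (use that K[OF that(1)] in \<open>auto simp: colorful_iff bij_betw_def inj_on_def\<close>)
  have mate_ex: "\<exists>u\<in>\<rho>. col u = col v" if "\<rho> \<in> K" "v \<in> vertices C" for \<rho> v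
  proof -
    have "col v \<in> col ` \<rho>"
      using K[OF that(1)] col_vertex(1)[OF that(2)] by (simp add: colorful_iff bij_betw_def)
    then show ?thesis by (metis imageE)
  qed
  have swap: "swap x \<in> S \<and> swap (swap x) = x \<and> f (swap x) = - f x" if "x \<in> S" for x
  proof -
    obtain \<rho> v where x: "x = (\<rho>, v)" by fastforce
    then have v: "\<rho> \<in> K" "v \<in> vertices C" "v \<notin> \<rho>" "insert v \<rho> \<in> C"
      using that by (auto simp: S_def)
    obtain u where u: "u \<in> \<rho>" "col u = col v" using mate_ex[OF v(1,2)] by blast
    let ?\<rho> = "insert v (\<rho> - {u})"
    have mate_v: "mate \<rho> v = u" using mate v u by blast
    have \<rho>': "?\<rho> \<in> K" using closed[OF v(1) colorful_swap[OF K[OF v(1)] v(3,4) u]] .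
    have mate_u: "mate ?\<rho> u = v" using mate[OF \<rho>'] u(2) by simp
    have ins: "insert u ?\<rho> = insert v \<rho>" using u by auto
    have "insert u (?\<rho> - {v}) = \<rho>" using u v by auto
    moreover have uv: "u \<noteq> v" using u v by auto
    moreover have "u \<in> vertices C" using u v(4) by (auto simp: vertices_def)
    ultimately have 1: "swap x \<in> S" "swap (swap x) = x"
      using v \<rho>' by (auto simp: x swap_def mate_v mate_u S_def ins)
    let ?A = "\<rho> - {u}"
    have fin: "finite ?A" using finite_simplex[OF v(4)] by simp
    have col_A: "col w \<noteq> col u" if "w \<in> ?A" for w
      using that u K[OF v(1)] by (auto simp: colorful_iff bij_betw_def inj_on_def)
    \<comment> \<open>No remaining vertex shares the colour of \<open>u\<close> and
      \<open>v\<close>, so the order cannot separate the two.\<close>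
    then have "{w \<in> ?A. col_less w u} = {w \<in> ?A. col_less w v}"
      using u by (auto simp: col_less_def)
    then have A: "sign_at col_less u ?A = sign_at col_less v ?A" by (simp add: sign_at_def)
    have "insert u ?A = \<rho>" using u by auto
    then have "sign_at col_less v \<rho> =
        (if col_less u v then - sign_at col_less v ?A else sign_at col_less v ?A)"
      using sign_at_insert[OF fin, of u col_less v] by simp
    moreover have "sign_at col_less u ?\<rho> =
        (if col_less v u then - sign_at col_less u ?A else sign_at col_less u ?A)"
      by (rule sign_at_insert[OF fin]) (use v in simp)
    ultimately have "sign_at col_less u ?\<rho> = - sign_at col_less v \<rho>"
      using A col_less_total[OF uv] by simp
    then have "f (swap x) = - f x"
      by (simp add: x swap_def mate_v f_def ins)
    with 1 show ?thesis by simp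
  qed
  have "(\<Sum>\<rho>\<in>K. bdy h \<rho>) = (\<Sum>\<rho>\<in>K. \<Sum>v\<in>{v \<in> vertices C - \<rho>. insert v \<rho> \<in> C}. f (\<rho>, v))"
    unfolding boundary_def f_def
    by (intro sum.cong refl sum.mono_neutral_cong_right) (use finite_vertices h in auto)
  also have "\<dots> = sum f S"
    unfolding S_def using fin_K finite_vertices by (subst sum.Sigma) (auto simp: case_prod_unfold)
  finally have *: "(\<Sum>\<rho>\<in>K. bdy h \<rho>) = sum f S" .
  have "sum f S = (\<Sum>x\<in>S. - f x)"
    by (rule sum.reindex_bij_witness[of _ swap swap]) (use swap in auto)
  then have "sum f S = 0" by (simp add: sum_negf)
  with * show ?thesis by simp
qed

text \<open>The coefficients of the boundary of the full prism are summed over the component of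
  \<open>\<sigma>\<close> in two ways. If \<open>\<tau>\<close> is elsewhere, the ends contribute -1
  and the sides nothing, since each side misses a colour; cancellation in pairs gives 0.\<close>

theorem RG_reachable_of_hom_vanish:
  assumes hom: "\<And>I. I \<subseteq> {1..n} \<Longrightarrow> I \<noteq> {} \<Longrightarrow> hom_vanish (induced C (vertices_in I)) (card I)"
    and \<sigma>: "colorful C n V \<sigma>" and \<tau>: "colorful C n V \<tau>"
  shows "(RG_adj C n V)\<^sup>*\<^sup>* \<sigma> \<tau>"
proof (rule ccontr)
  assume unreachable: "\<not> ?thesis"
  define K where "K = {\<rho>. (RG_adj C n V)\<^sup>*\<^sup>* \<sigma> \<rho>}"
  have K: "colorful C n V \<rho>" if "\<rho> \<in> K" for \<rho>
    using that \<sigma> unfolding K_def by (auto elim: rtranclp.cases simp: RG_adj_def)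
  then have "K \<subseteq> C" by (auto simp: colorful_iff)
  then have fin_K: "finite K" using finite_complex finite_subset by blast
  obtain h where "\<forall>I. I \<subseteq> {1..n} \<longrightarrow> card I \<le> n \<longrightarrow>
      (\<forall>\<rho>. h I \<rho> \<noteq> 0 \<longrightarrow> \<rho> \<in> C \<and> \<rho> \<subseteq> vertices_in I \<and> card \<rho> = Suc (card I)) \<and>
      (\<forall>\<rho>. finite \<rho> \<longrightarrow> bdy (h I) \<rho> = prism_ends \<sigma> \<tau> I \<rho> - prism_sides h I \<rho>)"
    using prism_chains[OF hom \<sigma> \<tau>] by (rule exE)
  note h = this[rule_format, THEN conjunct1, rule_format] this[rule_format, THEN conjunct2, rule_format]
  have card_le: "card I \<le> n" if "I \<subseteq> {1..n}" for I
    using card_mono[OF _ that] by simp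
  have supp: "\<rho> \<in> C" "\<rho> \<subseteq> vertices_in I" if "I \<subseteq> {1..n}" "h I \<rho> \<noteq> 0" for I \<rho>
    using h(1)[OF that(1) card_le[OF that(1)] that(2)] by auto
  have "bdy (h {1..n}) \<rho> = - of_bool (\<rho> = \<sigma>)" if "\<rho> \<in> K" for \<rho>
  proof -
    have col_\<rho>: "col ` \<rho> = {1..n}" and fin: "finite \<rho>"
      using K[OF that] finite_simplex by (auto simp: colorful_iff bij_betw_def)
    have "h ({1..n} - {i}) \<rho> = 0" if i: "i \<in> {1..n}" for i
    proof (rule ccontr)
      assume "h ({1..n} - {i}) \<rho> \<noteq> 0"
      then have "\<rho> \<subseteq> vertices_in ({1..n} - {i})" using supp(2)[of "{1..n} - {i}"] by auto
      then have "i \<notin> col ` \<rho>" by (auto simp: vertices_in_def)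
      with col_\<rho> i show False by simp
    qed
    then have "prism_sides h {1..n} \<rho> = 0" by (simp add: prism_sides_def)
    moreover have "part \<rho>' {1..n} = \<rho>'" if "colorful C n V \<rho>'" for \<rho>'
      using that by (auto simp: part_def colorful_iff bij_betw_def)
    moreover have "\<rho> \<noteq> \<tau>" using that unreachable by (auto simp: K_def)
    ultimately show ?thesis using h(2)[of "{1..n}" \<rho>] fin \<sigma> \<tau> by (simp add: prism_ends_def)
  qed
  then have "(\<Sum>\<rho>\<in>K. bdy (h {1..n}) \<rho>) = (\<Sum>\<rho>\<in>K. - of_bool (\<rho> = \<sigma>))" by simp
  also have "\<dots> = - 1" using fin_K by (simp add: sum_negf K_def)
  finally have "(\<Sum>\<rho>\<in>K. bdy (h {1..n}) \<rho>) = - 1" .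
  moreover have "(\<Sum>\<rho>\<in>K. bdy (h {1..n}) \<rho>) = 0"
    by (rule sum_boundary_component) (use K supp(1)[of "{1..n}"] in \<open>auto simp: K_def\<close>)
  ultimately show False by simp
qed

end

section \<open>Balls of positively homogeneous gauges\<close>

definition geom :: "'v set set \<Rightarrow> ('v \<Rightarrow> real) set" where
  "geom C = {f. (\<forall>v. 0 \<le> f v) \<and> {v. f v \<noteq> 0} \<in> C \<and> (\<Sum>v\<in>{v. f v \<noteq> 0}. f v) = 1}"

lemma realization_eq: "realization C = top_of_set (geom C)"
  by (simp add: realization_def geom_def euclidean_product_topology)

definition usphere :: "nat \<Rightarrow> (nat \<Rightarrow> real) set" where
  "usphere j = {x. (\<Sum>k\<le>j. x k ^ 2) = 1 \<and> (\<forall>k>j. x k = 0)}"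

definition uball :: "nat \<Rightarrow> (nat \<Rightarrow> real) set" where
  "uball j = {x. (\<Sum>k\<le>j. x k ^ 2) \<le> 1 \<and> (\<forall>k>j. x k = 0)}"

lemma nsphere_eq: "nsphere j = top_of_set (usphere j)"
  by (simp add: nsphere usphere_def euclidean_product_topology)

lemma nball_eq: "nball j = top_of_set (uball j)"
  by (simp add: nball_def uball_def Euclidean_space_def euclidean_product_topology subtopology_subtopology
      Suc_le_eq Collect_conj_eq Int_commute)

definition supported :: "nat set \<Rightarrow> (nat \<Rightarrow> real) set" where
  "supported I = {y. \<forall>i. i \<notin> I \<longrightarrow> y i = 0}"

lemma continuous_on_proj: "continuous_on S (\<lambda>y. y i :: real)"
  by (rule continuous_on_subset[OF continuous_on_product_coordinates]) simp

text \<open>\<open>N\<close> plays the role of a norm on the coordinate space of dimension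
  \<open>Suc j\<close>. Homogeneity concerns nonnegative factors only, because the cells to which it
  is applied need not be symmetric about their centres.\<close>

locale gauge =
  fixes I :: "nat set" and j :: nat and N :: "(nat \<Rightarrow> real) \<Rightarrow> real"
  assumes fin: "finite I" and card_I: "card I = Suc j"
    and N_cont: "continuous_on UNIV N"
    and N_scale: "\<And>r y. 0 \<le> r \<Longrightarrow> N (\<lambda>i. r * y i) = r * N y"
    and N_pos: "\<And>y. y \<in> supported I \<Longrightarrow> y \<noteq> (\<lambda>_. 0) \<Longrightarrow> 0 < N y"
begin

definition gsphere :: "(nat \<Rightarrow> real) set" where
  "gsphere = {y \<in> supported I. N y = 1}"

definition gball :: "(nat \<Rightarrow> real) set" where
  "gball = {y \<in> supported I. N y \<le> 1}"

definition enum :: "nat \<Rightarrow> nat" where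
  "enum = (SOME e. bij_betw e {..j} I)"

definition to_std :: "(nat \<Rightarrow> real) \<Rightarrow> nat \<Rightarrow> real" where
  "to_std y k = (if k \<le> j then y (enum k) else 0)"

definition of_std :: "(nat \<Rightarrow> real) \<Rightarrow> nat \<Rightarrow> real" where
  "of_std x i = (if i \<in> I then x (inv_into {..j} enum i) else 0)"

definition len :: "(nat \<Rightarrow> real) \<Rightarrow> real" where
  "len y = sqrt (\<Sum>i\<in>I. (y i)\<^sup>2)"

lemma N_zero: "N (\<lambda>_. 0) = 0"
  using N_scale[of 0 "\<lambda>_. 0"] by simp

lemma N_nonneg: "y \<in> supported I \<Longrightarrow> 0 \<le> N y"
  using N_pos[of y] N_zero by (cases "y = (\<lambda>_. 0)") auto

lemma enum_bij: "bij_betw enum {..j} I"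
proof -
  have "\<exists>e. bij_betw e {..j} I"
    by (rule finite_same_card_bij) (use fin card_I in auto)
  then show ?thesis unfolding enum_def by (rule someI_ex)
qed

lemma to_std_of_std: "(\<And>k. k > j \<Longrightarrow> x k = 0) \<Longrightarrow> to_std (of_std x) = x"
proof
  fix k assume x: "\<And>k. k > j \<Longrightarrow> x k = 0"
  show "to_std (of_std x) k = x k"
  proof (cases "k \<le> j")
    case True
    then have "enum k \<in> I" "inv_into {..j} enum (enum k) = k"
      using enum_bij by (auto simp: bij_betw_def)
    then show ?thesis using True by (simp add: to_std_def of_std_def)
  qed (use x in \<open>simp add: to_std_def\<close>)
qed

lemma of_std_to_std: "y \<in> supported I \<Longrightarrow> of_std (to_std y) = y"
proof
  fix i assume y: "y \<in> supported I"
  show "of_std (to_std y) i = y i"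
  proof (cases "i \<in> I")
    case True
    then have "i \<in> enum ` {..j}" using enum_bij by (simp add: bij_betw_def)
    then have "inv_into {..j} enum i \<in> {..j}" "enum (inv_into {..j} enum i) = i"
      by (rule inv_into_into, rule f_inv_into_f)
    then show ?thesis using True by (simp add: to_std_def of_std_def)
  qed (use y in \<open>simp add: of_std_def supported_def\<close>)
qed

lemma of_std_supported: "of_std x \<in> supported I"
  by (simp add: supported_def of_std_def)

lemma sum_to_std: "(\<Sum>k\<le>j. (to_std y k)\<^sup>2) = (\<Sum>i\<in>I. (y i)\<^sup>2)"
  using sum.reindex_bij_betw[OF enum_bij, of "\<lambda>i. (y i)\<^sup>2"] by (simp add: to_std_def)

lemma len_pos: "y \<in> supported I \<Longrightarrow> y \<noteq> (\<lambda>_. 0) \<Longrightarrow> 0 < len y"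
proof -
  assume y: "y \<in> supported I" "y \<noteq> (\<lambda>_. 0)"
  then obtain i where i: "y i \<noteq> 0" by auto
  with y have "i \<in> I" by (auto simp: supported_def)
  then have "0 < (\<Sum>i\<in>I. (y i)\<^sup>2)"
    by (intro sum_pos2[OF fin, of i]) (use i in auto)
  then show ?thesis by (simp add: len_def)
qed

lemma to_std_le_len: "\<bar>to_std y k\<bar> \<le> len y"
proof (cases "k \<le> j")
  case True
  then have "enum k \<in> I" using enum_bij by (auto simp: bij_betw_def)
  then have "(y (enum k))\<^sup>2 \<le> (\<Sum>i\<in>I. (y i)\<^sup>2)"
    by (intro member_le_sum) (use fin in auto)
  then show ?thesis
    using True by (simp add: to_std_def len_def real_le_rsqrt)
qed (simp add: to_std_def len_def sum_nonneg)

lemma continuous_on_len: "continuous_on S len"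
  unfolding len_def by (intro continuous_intros continuous_on_proj)

lemma continuous_on_to_std: "continuous_on S (\<lambda>y. to_std y k)"
  unfolding to_std_def by (cases "k \<le> j") (auto intro: continuous_on_proj)

lemma continuous_on_of_std: "continuous_on S of_std"
proof (rule continuous_on_coordinatewise_then_product)
  show "continuous_on S (\<lambda>x. of_std x i)" for i
    unfolding of_std_def by (cases "i \<in> I") (auto intro: continuous_on_proj)
qed

lemma continuous_on_N: "continuous_on S f \<Longrightarrow> continuous_on S (\<lambda>x. N (f x))"
  using continuous_on_compose2[OF N_cont] by blast

text \<open>The radial map that keeps the direction of \<open>y\<close> and gives it Euclidean
  length \<open>N y\<close>; the origin goes to the origin.\<close>

definition to_uball :: "(nat \<Rightarrow> real) \<Rightarrow> nat \<Rightarrow> real" where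
  "to_uball y k = N y * (to_std y k / len y)"

definition of_usphere :: "(nat \<Rightarrow> real) \<Rightarrow> nat \<Rightarrow> real" where
  "of_usphere x i = of_std x i / N (of_std x)"

lemma sum_to_uball:
  assumes "y \<in> supported I" "y \<noteq> (\<lambda>_. 0)"
  shows "(\<Sum>k\<le>j. (to_uball y k)\<^sup>2) = (N y)\<^sup>2"
proof -
  have "(\<Sum>k\<le>j. (to_uball y k)\<^sup>2) = (N y)\<^sup>2 / (len y)\<^sup>2 * (\<Sum>k\<le>j. (to_std y k)\<^sup>2)"
    by (simp add: to_uball_def power_mult_distrib power_divide sum_distrib_left)
  also have "(\<Sum>k\<le>j. (to_std y k)\<^sup>2) = (len y)\<^sup>2"
    by (simp add: sum_to_std len_def sum_nonneg)
  finally show ?thesis using len_pos[OF assms] by simp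
qed

lemma to_uball_gsphere: "y \<in> gsphere \<Longrightarrow> to_uball y \<in> usphere j"
proof -
  assume y: "y \<in> gsphere"
  then have "y \<noteq> (\<lambda>_. 0)" using N_zero by (auto simp: gsphere_def)
  then show ?thesis
    using y sum_to_uball[of y] by (simp add: usphere_def gsphere_def) (simp add: to_uball_def to_std_def)
qed

lemma to_uball_gball: "y \<in> gball \<Longrightarrow> to_uball y \<in> uball j"
proof -
  assume y: "y \<in> gball"
  have "(\<Sum>k\<le>j. (to_uball y k)\<^sup>2) \<le> 1"
  proof (cases "y = (\<lambda>_. 0)")
    case True
    then show ?thesis using N_zero by (simp add: to_uball_def)
  next
    case False
    then show ?thesis
      using y N_nonneg[of y] sum_to_uball[of y] by (simp add: gball_def power_le_one)
  qed
  then show ?thesis by (simp add: uball_def) (simp add: to_uball_def to_std_def)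
qed

text \<open>Away from the origin this is a quotient of continuous functions. At the origin each
  coordinate is squeezed by \<open>N\<close>, as no coordinate exceeds \<open>len\<close>.\<close>

lemma continuous_on_to_uball: "continuous_on gball to_uball"
proof (rule continuous_on_coordinatewise_then_product)
  fix k
  have lim: "(N \<longlongrightarrow> N y) (at y within gball)" "(len \<longlongrightarrow> len y) (at y within gball)"
    "((\<lambda>y. to_std y k) \<longlongrightarrow> to_std y k) (at y within gball)" if "y \<in> gball" for y
    using that continuous_on_subset[OF N_cont subset_UNIV, of gball]
      continuous_on_len[of gball] continuous_on_to_std[of gball k]
    by (auto simp: continuous_on_def)
  show "continuous_on gball (\<lambda>y. to_uball y k)"
    unfolding continuous_on_def
  proof
    fix y assume y: "y \<in> gball"
    show "((\<lambda>y. to_uball y k) \<longlongrightarrow> to_uball y k) (at y within gball)"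
    proof (cases "y = (\<lambda>_. 0)")
      case False
      then have "len y \<noteq> 0" using len_pos[of y] y by (auto simp: gball_def)
      then show ?thesis unfolding to_uball_def by (intro tendsto_intros lim y)
    next
      case True
      have bound: "norm (to_uball x k) \<le> N x" if "x \<in> gball" for x
      proof -
        have "\<bar>to_std x k / len x\<bar> \<le> 1"
          using to_std_le_len[of x k] by (auto simp: divide_le_eq_1 abs_divide)
        then show ?thesis
          using N_nonneg[of x] that mult_left_le[of "\<bar>to_std x k / len x\<bar>" "N x"]
          by (simp add: to_uball_def gball_def abs_mult)
      qed
      have "((\<lambda>y. to_uball y k) \<longlongrightarrow> 0) (at y within gball)"
      proof (rule Lim_null_comparison)
        show "\<forall>\<^sub>F x in at y within gball. norm (to_uball x k) \<le> N x"
          unfolding eventually_at_filter by (rule eventuallyI) (use bound in blast)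
        show "(N \<longlongrightarrow> 0) (at y within gball)" using lim(1)[OF y] True N_zero by simp
      qed
      then show ?thesis using True N_zero by (simp add: to_uball_def)
    qed
  qed
qed

lemma gsphere_subset_gball: "gsphere \<subseteq> gball"
  by (auto simp: gsphere_def gball_def)

lemma of_std_nonzero: "x \<in> usphere j \<Longrightarrow> of_std x \<noteq> (\<lambda>_. 0)"
proof
  assume x: "x \<in> usphere j" and "of_std x = (\<lambda>_. 0)"
  then have "to_std (\<lambda>_. 0) = x" using to_std_of_std[of x] by (simp add: usphere_def)
  then have "x k = 0" for k by (auto simp: to_std_def)
  with x show False by (simp add: usphere_def)
qed

text \<open>Every ray from the origin meets each of the two spheres exactly once, and homogeneity of
  \<open>N\<close> and \<open>len\<close> makes the two rescalings mutually inverse.\<close>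

lemma homeomorphic_maps_gsphere:
  "homeomorphic_maps (top_of_set gsphere) (nsphere j) to_uball of_usphere"
  unfolding homeomorphic_maps_def nsphere_eq continuous_map_subtopology_eu
proof (intro conjI ballI)
  show "continuous_on gsphere to_uball"
    using continuous_on_to_uball gsphere_subset_gball by (rule continuous_on_subset)
  show "to_uball \<in> gsphere \<rightarrow> usphere j" using to_uball_gsphere by blast
  have N_of_std: "N (of_std x) > 0" if "x \<in> usphere j" for x
    using N_pos[OF of_std_supported of_std_nonzero[OF that]] .
  show "continuous_on (usphere j) of_usphere"
  proof (rule continuous_on_coordinatewise_then_product)
    fix i
    show "continuous_on (usphere j) (\<lambda>x. of_usphere x i)"
      unfolding of_usphere_def
      by (intro continuous_on_divide continuous_on_N continuous_on_of_std ballI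
          continuous_on_product_then_coordinatewise[OF continuous_on_of_std]) (use N_of_std in force)
  qed
  show "of_usphere \<in> usphere j \<rightarrow> gsphere"
  proof
    fix x assume x: "x \<in> usphere j"
    have "N (\<lambda>i. (1 / N (of_std x)) * of_std x i) = 1"
      using N_of_std[OF x] by (subst N_scale) auto
    then show "of_usphere x \<in> gsphere"
      using of_std_supported[of x] by (simp add: gsphere_def of_usphere_def[abs_def] supported_def)
  qed
next
  fix y assume "y \<in> topspace (top_of_set gsphere)"
  then have y: "y \<in> supported I" "N y = 1" by (auto simp: gsphere_def)
  then have "y \<noteq> (\<lambda>_. 0)" using N_zero by auto
  then have len: "len y > 0" using len_pos[OF y(1)] by blast
  have *: "of_std (to_uball y) = (\<lambda>i. (1 / len y) * y i)"
  proof
    fix i show "of_std (to_uball y) i = 1 / len y * y i"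
      using fun_cong[OF of_std_to_std[OF y(1)], of i] y(2) by (simp add: of_std_def to_uball_def split: if_splits)
  qed
  have "N (of_std (to_uball y)) = 1 / len y"
    unfolding * by (subst N_scale) (use len y in auto)
  then show "of_usphere (to_uball y) = y"
    using len by (simp add: of_usphere_def[abs_def] *)
next
  fix x assume "x \<in> topspace (top_of_set (usphere j))"
  then have x: "x \<in> usphere j" by simp
  have Npos: "N (of_std x) > 0" using N_pos[OF of_std_supported of_std_nonzero[OF x]] .
  have eq: "to_std (of_std x) = x" using x to_std_of_std by (simp add: usphere_def)
  have N1: "N (of_usphere x) = 1"
    using Npos N_scale[of "1 / N (of_std x)" "of_std x"] by (simp add: of_usphere_def[abs_def])
  have "len (of_std x) = 1"
    using x sum_to_std[of "of_std x"] by (simp add: len_def eq usphere_def)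
  moreover have "len (of_usphere x) = len (of_std x) / N (of_std x)"
    using Npos by (simp add: len_def of_usphere_def[abs_def] power_divide real_sqrt_divide flip: sum_divide_distrib)
  ultimately have "len (of_usphere x) = 1 / N (of_std x)" by simp
  moreover have "to_std (of_usphere x) k = x k / N (of_std x)" for k
    using fun_cong[OF eq, of k] by (simp add: to_std_def of_usphere_def split: if_splits)
  ultimately show "to_uball (of_usphere x) = x"
    using Npos N1 by (simp add: to_uball_def[abs_def])
qed

section \<open>Extending maps over gauge balls and finding zeros\<close>

lemma not_contractible_gsphere: "\<not> contractible gsphere"
proof -
  have "top_of_set gsphere homeomorphic_space nsphere j"
    using homeomorphic_maps_gsphere homeomorphic_maps_imp_homeomorphic_space by blast
  then show ?thesis
    using homeomorphic_space_contractibility non_contractible_space_nsphere contractible_space_top_of_set by blast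
qed

text \<open>The map is pulled back to the standard sphere by \<open>of_usphere\<close>, extended
  over the standard ball by connectivity, and composed with \<open>to_uball\<close>.\<close>

lemma gauge_extend:
  assumes conn: "htpy_conn_at C (int j)"
    and f: "continuous_on gsphere f" "f \<in> gsphere \<rightarrow> geom C"
  shows "\<exists>g. continuous_on gball g \<and> g \<in> gball \<rightarrow> geom C \<and> (\<forall>y\<in>gsphere. g y = f y)"
proof -
  note hom = homeomorphic_maps_gsphere[unfolded homeomorphic_maps_def nsphere_eq continuous_map_subtopology_eu]
  have cont: "continuous_on (usphere j) (f \<circ> of_usphere)"
    by (rule continuous_on_compose2[OF f(1), unfolded o_def[symmetric]]) (use hom in \<open>auto simp: o_def\<close>)
  have maps: "f \<circ> of_usphere \<in> usphere j \<rightarrow> geom C"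
    using hom f(2) by auto
  from conn cont maps obtain g where g: "continuous_on (uball j) g" "g \<in> uball j \<rightarrow> geom C"
    and gf: "\<forall>x\<in>usphere j. g x = (f \<circ> of_usphere) x"
    unfolding htpy_conn_at_def nsphere_eq nball_eq realization_eq continuous_map_subtopology_eu
    by (auto simp del: o_apply)
  show ?thesis
  proof (intro exI[of _ "\<lambda>y. g (to_uball y)"] conjI ballI)
    show "continuous_on gball (\<lambda>y. g (to_uball y))"
      by (rule continuous_on_compose2[OF g(1) continuous_on_to_uball]) (use to_uball_gball in blast)
    show "(\<lambda>y. g (to_uball y)) \<in> gball \<rightarrow> geom C" using g(2) to_uball_gball by blast
    show "g (to_uball y) = f y" if "y \<in> gsphere" for y
      using gf to_uball_gsphere[OF that] hom that by simp
  qed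
qed

text \<open>Without a zero, rescaling to gauge 1 would make the identity of the sphere homotopic to
  \<open>H\<close> restricted to it, and this restriction homotopic to a constant.\<close>

lemma gauge_hits_zero:
  assumes H: "continuous_on gball H" "H \<in> gball \<rightarrow> supported I"
    and boundary: "\<And>t y. 0 \<le> t \<Longrightarrow> t \<le> 1 \<Longrightarrow> y \<in> gsphere \<Longrightarrow> (\<lambda>i. (1 - t) * y i + t * H y i) \<noteq> (\<lambda>_. 0)"
  shows "\<exists>y\<in>gball. H y = (\<lambda>_. 0)"
proof (rule ccontr)
  assume "\<not> ?thesis"
  then have nonzero: "H y \<noteq> (\<lambda>_. 0)" if "y \<in> gball" for y using that by blast
  \<comment> \<open>Radial retraction of the punctured space \<open>Z\<close> onto the gauge
    sphere.\<close>
  define \<nu> where "\<nu> z i = z i / N z" for z :: "nat \<Rightarrow> real" and i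
  define Z where "Z = supported I - {\<lambda>_. 0}"
  have \<nu>_cont: "continuous_on Z \<nu>"
  proof (rule continuous_on_coordinatewise_then_product)
    show "continuous_on Z (\<lambda>z. \<nu> z i)" for i
      unfolding \<nu>_def
      by (intro continuous_on_divide continuous_on_N continuous_on_proj continuous_on_id ballI)
        (use N_pos in \<open>force simp: Z_def\<close>)
  qed
  have \<nu>_maps: "\<nu> z \<in> gsphere" if "z \<in> Z" for z
  proof -
    have "N z > 0" using that N_pos by (auto simp: Z_def)
    then have "N (\<nu> z) = 1" using N_scale[of "1 / N z" z] by (simp add: \<nu>_def[abs_def])
    then show ?thesis using that by (simp add: gsphere_def supported_def Z_def \<nu>_def)
  qed
  have homotopic: "homotopic_with_canon (\<lambda>_. True) gsphere gsphere p q"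
    if k: "continuous_on ({0..1} \<times> gsphere) k" and kZ: "\<And>t y. 0 \<le> t \<Longrightarrow> t \<le> 1 \<Longrightarrow> y \<in> gsphere \<Longrightarrow> k (t, y) \<in> Z"
      and pq: "\<And>y. y \<in> gsphere \<Longrightarrow> \<nu> (k (0, y)) = p y" "\<And>y. y \<in> gsphere \<Longrightarrow> \<nu> (k (1, y)) = q y"
    for k :: "real \<times> (nat \<Rightarrow> real) \<Rightarrow> nat \<Rightarrow> real" and p q
  proof (subst homotopic_with, simp, intro exI[of _ "\<lambda>x. \<nu> (k x)"] conjI ballI)
    have "continuous_on ({0..1} \<times> gsphere) (\<lambda>x. \<nu> (k x))"
      by (rule continuous_on_compose2[OF \<nu>_cont k]) (use kZ in auto)
    then show "continuous_map (prod_topology (top_of_set {0..1}) (top_of_set gsphere)) (top_of_set gsphere) (\<lambda>x. \<nu> (k x))"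
      unfolding prod_topology_subtopology_eu continuous_map_subtopology_eu
      using \<nu>_maps kZ by auto
  qed (use pq in auto)
  have c1: "continuous_on S (\<lambda>x. snd x i)" for S :: "(real \<times> (nat \<Rightarrow> real)) set" and i
    by (rule continuous_on_product_then_coordinatewise) (intro continuous_intros)
  have c2: "continuous_on ({0..1} \<times> gsphere) (\<lambda>x. H (snd x))"
    by (rule continuous_on_compose2[OF H(1)]) (use gsphere_subset_gball in \<open>auto intro: continuous_intros\<close>)
  \<comment> \<open>By hypothesis the segment from \<open>y\<close> to \<open>H y\<close> avoids the
    origin.\<close>
  have "homotopic_with_canon (\<lambda>_. True) gsphere gsphere id (\<lambda>y. \<nu> (H y))"
  proof (rule homotopic[of "\<lambda>x i. (1 - fst x) * snd x i + fst x * H (snd x) i"])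
    show "continuous_on ({0..1} \<times> gsphere) (\<lambda>x i. (1 - fst x) * snd x i + fst x * H (snd x) i)"
      by (rule continuous_on_coordinatewise_then_product)
        (intro continuous_intros c1 continuous_on_product_then_coordinatewise[OF c2])
    fix t :: real and y assume t: "0 \<le> t" "t \<le> 1" and y: "y \<in> gsphere"
    have "H y \<in> supported I" "y \<in> supported I"
      using H(2) y gsphere_subset_gball by (auto simp: gsphere_def)
    then show "(\<lambda>i. (1 - fst (t, y)) * snd (t, y) i + fst (t, y) * H (snd (t, y)) i) \<in> Z"
      using boundary[OF t y] by (simp add: Z_def supported_def)
  qed (auto simp: \<nu>_def[abs_def] gsphere_def)
  \<comment> \<open>Here \<open>y\<close> is moved to the origin inside the ball, where
    \<open>H\<close> is nowhere zero.\<close>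
  moreover have "homotopic_with_canon (\<lambda>_. True) gsphere gsphere (\<lambda>y. \<nu> (H y)) (\<lambda>_. \<nu> (H (\<lambda>_. 0)))"
  proof (rule homotopic[of "\<lambda>x. H (\<lambda>i. (1 - fst x) * snd x i)"])
    have in_ball: "(\<lambda>i. (1 - t) * y i) \<in> gball" if "0 \<le> t" "t \<le> 1" "y \<in> gsphere" for t y
      using that N_scale[of "1 - t" y] by (simp add: gball_def gsphere_def supported_def)
    show "continuous_on ({0..1} \<times> gsphere) (\<lambda>x. H (\<lambda>i. (1 - fst x) * snd x i))"
    proof (rule continuous_on_compose2[OF H(1)])
      show "continuous_on ({0..1} \<times> gsphere) (\<lambda>x i. (1 - fst x) * snd x i)"
        by (rule continuous_on_coordinatewise_then_product) (intro continuous_intros c1)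
    qed (use in_ball in auto)
    fix t :: real and y assume "0 \<le> t" "t \<le> 1" "y \<in> gsphere"
    then have "(\<lambda>i. (1 - t) * y i) \<in> gball" by (rule in_ball)
    then show "H (\<lambda>i. (1 - fst (t, y)) * snd (t, y) i) \<in> Z"
      using H(2) nonzero by (auto simp: Z_def)
  qed auto
  ultimately have "homotopic_with_canon (\<lambda>_. True) gsphere gsphere id (\<lambda>_. \<nu> (H (\<lambda>_. 0)))"
    by (rule homotopic_with_trans)
  then have "contractible gsphere" by (auto simp: contractible_def)
  then show False using not_contractible_gsphere by contradiction
qed

end

section \<open>Truncated cones over simplices\<close>

text \<open>The prism over the simplex spanned by \<open>I\<close>: the coordinate sum is the
  height, between 1 and 2, and dividing by it gives the point of the simplex. Faces are cut out by
  vanishing coordinates, and \<open>cell {}\<close> is empty.\<close>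

definition cell :: "nat set \<Rightarrow> (nat \<Rightarrow> real) set" where
  "cell I = {x. (\<forall>i. 0 \<le> x i) \<and> (\<forall>i. i \<notin> I \<longrightarrow> x i = 0) \<and> 1 \<le> sum x I \<and> sum x I \<le> 2}"

definition cell_boundary :: "nat set \<Rightarrow> (nat \<Rightarrow> real) set" where
  "cell_boundary I = {x \<in> cell I. sum x I = 1 \<or> sum x I = 2 \<or> (\<exists>i\<in>I. x i = 0)}"

text \<open>The point at height 3/2 over the barycentre.\<close>

definition center :: "nat set \<Rightarrow> nat \<Rightarrow> real" where
  "center I i = (if i \<in> I then 3 / (2 * real (card I)) else 0)"

text \<open>The Minkowski functional of the cell translated by its centre. The first term keeps the
  height within 1/2 of 3/2; the others express nonnegativity of the coordinates.\<close>

definition cell_gauge :: "nat set \<Rightarrow> (nat \<Rightarrow> real) \<Rightarrow> real" where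
  "cell_gauge I y = max (2 * \<bar>sum y I\<bar>) (Max ((\<lambda>i. 2 * real (card I) / 3 * - y i) ` I))"

lemma continuous_on_Max:
  fixes f :: "'i \<Rightarrow> 'a::topological_space \<Rightarrow> real"
  assumes "finite I" "I \<noteq> {}" "\<And>i. i \<in> I \<Longrightarrow> continuous_on S (f i)"
  shows "continuous_on S (\<lambda>x. Max ((\<lambda>i. f i x) ` I))"
  using assms
proof (induction I rule: finite_ne_induct)
  case (insert i I)
  then have "Max ((\<lambda>i. f i x) ` insert i I) = max (f i x) (Max ((\<lambda>i. f i x) ` I))" for x
    by simp
  with insert show ?case by (simp add: continuous_on_max)
qed simp

lemma sum_center: "finite I \<Longrightarrow> I \<noteq> {} \<Longrightarrow> sum (center I) I = 3 / 2"
  by (simp add: center_def)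

section \<open>The prism as a gauge ball around its centre\<close>

context
  fixes I :: "nat set"
  assumes fin: "finite I" and ne: "I \<noteq> {}"
begin

lemma card_pos: "0 < real (card I)"
  using fin ne by (simp add: card_gt_0_iff)

lemma cell_gauge_le_iff:
  assumes "0 \<le> c"
  shows "cell_gauge I y \<le> c \<longleftrightarrow> 2 * \<bar>sum y I\<bar> \<le> c \<and> (\<forall>i\<in>I. - y i \<le> c * (3 / (2 * real (card I))))"
proof -
  have "2 * real (card I) / 3 * - y i \<le> c \<longleftrightarrow> - y i \<le> c * (3 / (2 * real (card I)))" for i
    using card_pos by (simp add: field_simps)
  then show ?thesis using fin ne by (simp add: cell_gauge_def Max_le_iff)
qed

lemma cell_gauge_attained:
  "cell_gauge I y = 2 * \<bar>sum y I\<bar> \<or> (\<exists>i\<in>I. cell_gauge I y = 2 * real (card I) / 3 * - y i)"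
proof -
  have "Max ((\<lambda>i. 2 * real (card I) / 3 * - y i) ` I) \<in> (\<lambda>i. 2 * real (card I) / 3 * - y i) ` I"
    using fin ne by (intro Max_in) auto
  then show ?thesis unfolding cell_gauge_def max_def by (auto simp del: mult_minus_right)
qed

text \<open>For positivity: a vector of gauge at most 0 has coordinate sum 0 and nonnegative
  coordinates on \<open>I\<close>, so it vanishes there.\<close>

lemma gauge_cell_gauge:
  assumes j: "card I = Suc j"
  shows "gauge I j (cell_gauge I)"
proof
  show "continuous_on UNIV (cell_gauge I)"
    unfolding cell_gauge_def
    by (intro continuous_on_max continuous_on_Max fin ne continuous_intros continuous_on_product_coordinates)
  fix r :: real and y :: "nat \<Rightarrow> real" assume r: "0 \<le> r"
  let ?A = "(\<lambda>i. 2 * real (card I) / 3 * - y i) ` I"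
  have "mono ((*) r)" using r by (auto intro!: monoI mult_left_mono)
  then have "r * Max ?A = Max ((*) r ` ?A)"
    by (rule mono_Max_commute) (use fin ne in auto)
  moreover have "(*) r ` ?A = (\<lambda>i. 2 * real (card I) / 3 * - (r * y i)) ` I"
    by (auto simp: image_image mult.left_commute)
  moreover have "\<bar>sum (\<lambda>i. r * y i) I\<bar> = r * \<bar>sum y I\<bar>"
    using r by (simp add: abs_mult flip: sum_distrib_left)
  ultimately show "cell_gauge I (\<lambda>i. r * y i) = r * cell_gauge I y"
    using r by (simp add: cell_gauge_def max_mult_distrib_left mult.left_commute)
next
  fix y assume y: "y \<in> supported I" "y \<noteq> (\<lambda>_. 0)"
  show "0 < cell_gauge I y"
  proof (rule ccontr)
    assume "\<not> ?thesis"
    then have "cell_gauge I y \<le> 0" by simp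
    then have "sum y I = 0" "\<forall>i\<in>I. 0 \<le> y i" using cell_gauge_le_iff[of 0 y] by auto
    then have "\<forall>i\<in>I. y i = 0" using fin by (simp add: sum_nonneg_eq_0_iff)
    then have "y = (\<lambda>_. 0)" using y(1) by (auto simp: supported_def)
    with y(2) show False by contradiction
  qed
qed (use fin j in auto)

lemma cell_iff_gauge:
  "x \<in> cell I \<longleftrightarrow> (\<lambda>i. x i - center I i) \<in> supported I \<and> cell_gauge I (\<lambda>i. x i - center I i) \<le> 1"
    (is "_ \<longleftrightarrow> ?R")
proof -
  have s: "(\<Sum>i\<in>I. x i - center I i) = sum x I - 3 / 2"
    using sum_center[OF fin ne] by (simp add: sum_subtractf)
  have nonneg: "- (x i - center I i) \<le> 1 * (3 / (2 * real (card I))) \<longleftrightarrow> 0 \<le> x i" if "i \<in> I" for i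
    using that by (simp add: center_def)
  have "(\<lambda>i. x i - center I i) \<in> supported I \<longleftrightarrow> (\<forall>i. i \<notin> I \<longrightarrow> x i = 0)"
    by (simp add: supported_def center_def)
  moreover have "cell_gauge I (\<lambda>i. x i - center I i) \<le> 1 \<longleftrightarrow>
      2 * \<bar>sum x I - 3 / 2\<bar> \<le> 1 \<and> (\<forall>i\<in>I. 0 \<le> x i)"
    unfolding cell_gauge_le_iff[OF zero_le_one] s using nonneg by blast
  ultimately have "?R \<longleftrightarrow>
      (\<forall>i. i \<notin> I \<longrightarrow> x i = 0) \<and> 2 * \<bar>sum x I - 3 / 2\<bar> \<le> 1 \<and> (\<forall>i\<in>I. 0 \<le> x i)"
    by (simp only:)
  also have "\<dots> \<longleftrightarrow> x \<in> cell I"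
    unfolding cell_def by (auto simp: abs_le_iff field_simps)
  finally show ?thesis ..
qed

text \<open>Some term of the maximum equals 1, and each term corresponds to an end or a side of the
  prism.\<close>

lemma cell_boundary_if_gauge_1:
  assumes "x \<in> cell I" "cell_gauge I (\<lambda>i. x i - center I i) = 1"
  shows "x \<in> cell_boundary I"
  using cell_gauge_attained[of "\<lambda>i. x i - center I i"]
proof
  assume "cell_gauge I (\<lambda>i. x i - center I i) = 2 * \<bar>\<Sum>i\<in>I. x i - center I i\<bar>"
  moreover have "(\<Sum>i\<in>I. x i - center I i) = sum x I - 3 / 2"
    using sum_center[OF fin ne] by (simp add: sum_subtractf)
  ultimately have "sum x I = 1 \<or> sum x I = 2" using assms(2) by (auto simp: abs_if split: if_splits)
  then show ?thesis using assms(1) by (auto simp: cell_boundary_def)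
next
  assume "\<exists>i\<in>I. cell_gauge I (\<lambda>i. x i - center I i) = 2 * real (card I) / 3 * - (x i - center I i)"
  then obtain i where i: "i \<in> I" "1 = 2 * real (card I) / 3 * - (x i - 3 / (2 * real (card I)))"
    using assms(2) by (auto simp: center_def)
  then have "x i = 0" using card_pos by (simp add: field_simps)
  then show ?thesis using assms(1) i(1) by (auto simp: cell_boundary_def)
qed

text \<open>Up to translation by the centre this is \<open>gauge_extend\<close>. The cell has
  dimension \<open>card I\<close>, so its boundary is a sphere of dimension
  \<open>card I - 1\<close>.\<close>

lemma cell_extend:
  assumes conn: "htpy_conn_at C (int (card I) - 1)"
    and f: "continuous_on (cell_boundary I) f" "f \<in> cell_boundary I \<rightarrow> geom C"
  shows "\<exists>g. continuous_on (cell I) g \<and> g \<in> cell I \<rightarrow> geom C \<and> (\<forall>x\<in>cell_boundary I. g x = f x)"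
proof -
  obtain j where j: "card I = Suc j" using card_pos by (cases "card I") auto
  interpret gauge I j "cell_gauge I" by (rule gauge_cell_gauge[OF j])
  have cont_shift: "continuous_on S (\<lambda>x i. x i + c i)" for S and c :: "nat \<Rightarrow> real"
    by (intro continuous_on_coordinatewise_then_product continuous_intros continuous_on_proj)
  have shift: "(\<lambda>i. y i + center I i) \<in> cell_boundary I" if "y \<in> gsphere" for y
    using that cell_iff_gauge[of "\<lambda>i. y i + center I i"]
      cell_boundary_if_gauge_1[of "\<lambda>i. y i + center I i"] by (auto simp: gsphere_def)
  have "\<exists>g. continuous_on gball g \<and> g \<in> gball \<rightarrow> geom C \<and> (\<forall>y\<in>gsphere. g y = f (\<lambda>i. y i + center I i))"
  proof (rule gauge_extend)
    show "htpy_conn_at C (int j)" using conn j by simp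
    show "continuous_on gsphere (\<lambda>y. f (\<lambda>i. y i + center I i))"
      by (rule continuous_on_compose2[OF f(1) cont_shift]) (use shift in blast)
    show "(\<lambda>y. f (\<lambda>i. y i + center I i)) \<in> gsphere \<rightarrow> geom C" using f(2) shift by blast
  qed
  then obtain g where g: "continuous_on gball g" "g \<in> gball \<rightarrow> geom C"
    and gf: "\<And>y. y \<in> gsphere \<Longrightarrow> g y = f (\<lambda>i. y i + center I i)" by blast
  have unshift: "(\<lambda>i. x i + - center I i) \<in> gball" if "x \<in> cell I" for x
    using that cell_iff_gauge[of x] by (simp add: gball_def)
  have sphere: "(\<lambda>i. x i + - center I i) \<in> gsphere" if x: "x \<in> cell_boundary I" for x
  proof -
    have "x \<in> cell I" using x by (simp add: cell_boundary_def)
    then have supp: "(\<lambda>i. x i - center I i) \<in> supported I" and le: "cell_gauge I (\<lambda>i. x i - center I i) \<le> 1"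
      using cell_iff_gauge by auto
    \<comment> \<open>A gauge below 1 would make all the inequalities defining the cell strict,
      contrary to \<open>x\<close> being on the boundary.\<close>
    have "1 \<le> cell_gauge I (\<lambda>i. x i - center I i)"
    proof (rule ccontr)
      assume "\<not> ?thesis"
      then obtain c where c: "cell_gauge I (\<lambda>i. x i - center I i) \<le> c" "0 \<le> c" "c < 1"
        using N_nonneg[OF supp] by (metis linorder_not_le order_refl)
      have "(\<Sum>i\<in>I. x i - center I i) = sum x I - 3 / 2"
        using sum_center[OF fin ne] by (simp add: sum_subtractf)
      then have "2 * \<bar>sum x I - 3 / 2\<bar> < 1"
        using c cell_gauge_le_iff[of c "\<lambda>i. x i - center I i"] by simp
      moreover have "x i \<noteq> 0" if "i \<in> I" for i
      proof
        assume "x i = 0"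
        then have "3 / (2 * real (card I)) \<le> c * (3 / (2 * real (card I)))"
          using c that cell_gauge_le_iff[of c "\<lambda>i. x i - center I i"] by (force simp: center_def)
        with c(3) card_pos show False by (simp add: field_simps)
      qed
      ultimately show False using x by (auto simp: cell_boundary_def)
    qed
    then show ?thesis using supp le by (simp add: gsphere_def)
  qed
  show ?thesis
  proof (intro exI[of _ "\<lambda>x. g (\<lambda>i. x i + - center I i)"] conjI ballI)
    show "continuous_on (cell I) (\<lambda>x. g (\<lambda>i. x i + - center I i))"
      by (rule continuous_on_compose2[OF g(1) cont_shift]) (use unshift in blast)
    show "(\<lambda>x. g (\<lambda>i. x i + - center I i)) \<in> cell I \<rightarrow> geom C" using g(2) unshift by blast
    show "g (\<lambda>i. x i + - center I i) = f x" if "x \<in> cell_boundary I" for x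
      using gf[OF sphere[OF that]] by simp
  qed
qed

text \<open>If the centre were missed, no segment from a boundary point \<open>x\<close> to
  \<open>H x\<close> would meet it: on a side a coordinate stays 0, and on an end the height stays
  on its side of 3/2. This is the boundary condition of \<open>gauge_hits_zero\<close>.\<close>

lemma cell_hits_center:
  assumes H: "continuous_on (cell I) H" "H \<in> cell I \<rightarrow> supported I"
    and side: "\<And>x i. x \<in> cell I \<Longrightarrow> i \<in> I \<Longrightarrow> x i = 0 \<Longrightarrow> H x i = 0"
    and bottom: "\<And>x. x \<in> cell I \<Longrightarrow> sum x I = 1 \<Longrightarrow> sum (H x) I \<le> 3 / 2"
    and top: "\<And>x. x \<in> cell I \<Longrightarrow> sum x I = 2 \<Longrightarrow> 3 / 2 \<le> sum (H x) I"
  shows "\<exists>x\<in>cell I. H x = center I"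
proof (rule ccontr)
  assume no: "\<not> ?thesis"
  obtain j where j: "card I = Suc j" using card_pos by (cases "card I") auto
  interpret gauge I j "cell_gauge I" by (rule gauge_cell_gauge[OF j])
  let ?s = "\<lambda>y i. y i + center I i"
  have shift: "?s y \<in> cell I" if "y \<in> gball" for y
    using that cell_iff_gauge[of "?s y"] by (simp add: gball_def)
  have "\<exists>y\<in>gball. (\<lambda>i. H (?s y) i - center I i) = (\<lambda>_. 0)"
  proof (rule gauge_hits_zero)
    have "continuous_on gball (\<lambda>y. H (?s y))"
    proof (rule continuous_on_compose2[OF H(1)])
      show "continuous_on gball ?s"
        by (intro continuous_on_coordinatewise_then_product continuous_intros continuous_on_proj)
    qed (use shift in blast)
    note coord = continuous_on_product_then_coordinatewise[OF this]
    show "continuous_on gball (\<lambda>y i. H (?s y) i - center I i)"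
      by (rule continuous_on_coordinatewise_then_product) (rule continuous_on_diff[OF coord continuous_on_const])
    show "(\<lambda>y i. H (?s y) i - center I i) \<in> gball \<rightarrow> supported I"
    proof
      fix y assume "y \<in> gball"
      then have "H (?s y) \<in> supported I" using H(2) shift by blast
      then show "(\<lambda>i. H (?s y) i - center I i) \<in> supported I"
        by (simp add: supported_def center_def)
    qed
    fix t :: real and y assume t: "0 \<le> t" "t \<le> 1" and y: "y \<in> gsphere"
    have in_ball: "y \<in> gball" using y gsphere_subset_gball by blast
    have x: "?s y \<in> cell I" using shift[OF in_ball] .
    then have bd: "?s y \<in> cell_boundary I"
      using y by (intro cell_boundary_if_gauge_1) (auto simp: gsphere_def)
    show "(\<lambda>i. (1 - t) * y i + t * (H (?s y) i - center I i)) \<noteq> (\<lambda>_. 0)"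
    proof
      assume eq: "(\<lambda>i. (1 - t) * y i + t * (H (?s y) i - center I i)) = (\<lambda>_. 0)"
      \<comment> \<open>The bounds at bottom and top are weak, so the endpoint \<open>H x\<close>
        itself is excluded by the assumption that the centre is missed.\<close>
      have "t \<noteq> 1"
      proof
        assume "t = 1"
        with eq have "H (?s y) = center I" by (auto simp: fun_eq_iff)
        with no x show False by blast
      qed
      with t have t1: "t < 1" by simp
      have sum_eq: "(1 - t) * sum y I + t * (sum (H (?s y)) I - 3 / 2) = 0"
      proof -
        have "(\<Sum>i\<in>I. (1 - t) * y i + t * (H (?s y) i - center I i)) = 0"
          using eq by (simp add: fun_eq_iff)
        then show ?thesis
          by (simp add: sum.distrib sum_subtractf sum_center[OF fin ne] flip: sum_distrib_left)
      qed
      have sum_x: "sum (?s y) I = sum y I + 3 / 2"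
        by (simp add: sum.distrib sum_center[OF fin ne])
      from bd consider "sum (?s y) I = 1" | "sum (?s y) I = 2" | i where "i \<in> I" "?s y i = 0"
        by (auto simp: cell_boundary_def)
      then show False
      proof cases
        case 1
        then have "(1 - t) * sum y I < 0" using t1 sum_x by (simp add: mult_pos_neg)
        moreover have "t * (sum (H (?s y)) I - 3 / 2) \<le> 0"
          using bottom[OF x 1] t(1) by (simp add: mult_nonneg_nonpos)
        ultimately show False using sum_eq by simp
      next
        case 2
        then have "(1 - t) * sum y I > 0" using t1 sum_x by simp
        moreover have "t * (sum (H (?s y)) I - 3 / 2) \<ge> 0"
          using top[OF x 2] t(1) by simp
        ultimately show False using sum_eq by simp
      next
        case 3
        then have yi: "y i = - center I i" by simp
        have "H (?s y) i = 0" using side[OF x 3] .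
        moreover have "(1 - t) * y i + t * (H (?s y) i - center I i) = 0" using fun_cong[OF eq] by simp
        ultimately have "center I i = 0" using yi by (simp add: algebra_simps)
        then show False using 3(1) card_pos by (simp add: center_def)
      qed
    qed
  qed
  then obtain y where "y \<in> gball" and eq: "(\<lambda>i. H (?s y) i - center I i) = (\<lambda>_. 0)" by blast
  then have "H (?s y) = center I" by (auto simp: fun_eq_iff)
  with no shift[OF \<open>y \<in> gball\<close>] show False by blast
qed

end

lemma closed_cell: "closed (cell I)"
proof -
  have "closed {x. \<forall>i. 0 \<le> (x i :: real)}"
    by (intro closed_Collect_all closed_Collect_le continuous_intros continuous_on_proj)
  moreover have "closed {x. \<forall>i. i \<notin> I \<longrightarrow> x i = (0 :: real)}"
    by (intro closed_Collect_all closed_Collect_imp closed_Collect_eq continuous_intros continuous_on_proj) simp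
  moreover have "continuous_on UNIV (\<lambda>x :: nat \<Rightarrow> real. sum x I)"
    by (intro continuous_on_sum continuous_on_proj)
  note closed_Collect_le[OF continuous_on_const[of _ 1] this] closed_Collect_le[OF this continuous_on_const[of _ 2]]
  ultimately show ?thesis
    unfolding cell_def by (intro closed_Collect_conj)
qed

lemma cell_empty: "cell {} = {}"
  by (simp add: cell_def)

lemma cell_subset:
  assumes "finite M" "I \<subseteq> M"
  shows "cell I = {x \<in> cell M. \<forall>i. i \<notin> I \<longrightarrow> x i = 0}"
proof -
  have "sum x I = sum x M" if "\<forall>i. i \<notin> I \<longrightarrow> x i = 0" for x :: "nat \<Rightarrow> real"
    using sum.mono_neutral_left[OF assms] that by auto
  then show ?thesis using assms(2) by (auto simp: cell_def)
qed

section \<open>Homotopical connectivity\<close>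

lemma geom_mono: "K \<subseteq> L \<Longrightarrow> geom K \<subseteq> geom L"
  by (auto simp: geom_def)

lemma geom_support: "f \<in> geom K \<Longrightarrow> {v. f v \<noteq> 0} \<in> K"
  by (simp add: geom_def)

lemma geom_nonneg: "f \<in> geom K \<Longrightarrow> 0 \<le> f v"
  by (simp add: geom_def)

context partitioned_complex
begin

text \<open>Sends level \<open>c\<close> of the prism to the simplex \<open>\<sigma>\<close>: the
  vertex of colour \<open>i\<close> receives the barycentric coordinate
  \<open>x i / c\<close>.\<close>

definition end_map :: "'v set \<Rightarrow> real \<Rightarrow> (nat \<Rightarrow> real) \<Rightarrow> 'v \<Rightarrow> real" where
  "end_map \<sigma> c x v = (if v \<in> \<sigma> then x (col v) / c else 0)"

lemma continuous_on_end_map: "continuous_on S (end_map \<sigma> c)"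
proof (rule continuous_on_coordinatewise_then_product)
  fix v
  have "continuous_on S (\<lambda>x. x (col v) * inverse c)"
    by (rule continuous_on_mult_right[OF continuous_on_proj])
  then show "continuous_on S (\<lambda>x. end_map \<sigma> c x v)"
    by (cases "v \<in> \<sigma>") (simp_all add: end_map_def divide_inverse)
qed

lemma end_map_in_geom:
  assumes \<sigma>: "colorful C n V \<sigma>" and I: "I \<subseteq> {1..n}" and x: "x \<in> cell I" and c: "sum x I = c" "0 < c"
  shows "end_map \<sigma> c x \<in> geom (induced C (vertices_in I))"
proof -
  have \<sigma>C: "\<sigma> \<in> C" and bij: "bij_betw col \<sigma> {1..n}" using \<sigma> by (auto simp: colorful_iff)
  let ?P = "{v. end_map \<sigma> c x v \<noteq> 0}"
  have P: "?P = {v \<in> \<sigma>. x (col v) \<noteq> 0}" using c(2) by (auto simp: end_map_def)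
  have "?P \<in> C" using \<sigma>C by (rule subset_simplex) (auto simp: P)
  moreover have "?P \<subseteq> vertices_in I"
    unfolding P using x simplex_subset_vertices[OF \<sigma>C] by (auto simp: vertices_in_def cell_def)
  moreover have "sum (end_map \<sigma> c x) ?P = 1"
  proof -
    have "sum (end_map \<sigma> c x) ?P = (\<Sum>v\<in>\<sigma>. x (col v) / c)"
      by (rule sum.mono_neutral_cong_left) (auto simp: P end_map_def finite_simplex[OF \<sigma>C])
    also have "\<dots> = (\<Sum>i\<in>{1..n}. x i / c)" by (rule sum.reindex_bij_betw[OF bij])
    also have "\<dots> = (\<Sum>i\<in>I. x i / c)"
      by (rule sum.mono_neutral_right) (use I x in \<open>auto simp: cell_def\<close>)
    also have "\<dots> = 1" using c by (simp flip: sum_divide_distrib)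
    finally show ?thesis .
  qed
  moreover have "0 \<le> end_map \<sigma> c x v" for v using x c(2) by (simp add: end_map_def cell_def)
  ultimately show ?thesis by (simp add: geom_def induced_def)
qed

lemma induced_vertices_in_mono: "J \<subseteq> I \<Longrightarrow> induced C (vertices_in J) \<subseteq> induced C (vertices_in I)"
  by (auto simp: induced_def vertices_in_def)

lemma sum_cell: "I \<subseteq> {1..n} \<Longrightarrow> x \<in> cell I \<Longrightarrow> sum x {1..n} = sum x I"
  by (rule sum.mono_neutral_right) (auto simp: cell_def)

text \<open>This writes the boundary as a finite union of closed sets, on which continuity can be
  glued. The height is summed over all colours so that it does not depend on
  \<open>I\<close>.\<close>

lemma cell_boundary_eq:
  assumes I: "I \<subseteq> {1..n}"
  shows "cell_boundary I = (cell I \<inter> {x. sum x {1..n} = 1}) \<union> (cell I \<inter> {x. sum x {1..n} = 2}) \<union> (\<Union>i\<in>I. cell (I - {i}))"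
proof -
  have fin: "finite I" using I finite_subset by blast
  have "cell (I - {i}) = {x \<in> cell I. x i = 0}" if "i \<in> I" for i
    unfolding cell_subset[OF fin Diff_subset] using that by (auto simp: cell_def)
  then have "(\<Union>i\<in>I. cell (I - {i})) = {x \<in> cell I. \<exists>i\<in>I. x i = 0}" by auto
  moreover have "sum x {1..n} = sum x I" if "x \<in> cell I" for x using sum_cell[OF I that] .
  ultimately show ?thesis by (auto simp: cell_boundary_def)
qed

text \<open>Induction on the number of colours. On the boundary of a new cell the map is already
  given by the two ends and the cells with one colour less; connectivity of the subcomplex of
  colours \<open>I\<close> extends it inside.\<close>

lemma prism_map:
  assumes conn: "\<And>I. I \<subseteq> {1..n} \<Longrightarrow> I \<noteq> {} \<Longrightarrow> htpy_conn_at (induced C (vertices_in I)) (int (card I) - 1)"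
    and \<sigma>: "colorful C n V \<sigma>" and \<tau>: "colorful C n V \<tau>"
  shows "\<exists>F. (\<forall>x. sum x {1..n} = 1 \<longrightarrow> F x = end_map \<sigma> 1 x) \<and>
    (\<forall>x. sum x {1..n} = 2 \<longrightarrow> F x = end_map \<tau> 2 x) \<and>
    (\<forall>I. I \<subseteq> {1..n} \<longrightarrow> card I \<le> k \<longrightarrow>
      continuous_on (cell I) F \<and> F \<in> cell I \<rightarrow> geom (induced C (vertices_in I)))"
    (is "\<exists>F. ?prism k F")
proof (induction k)
  case 0
  \<comment> \<open>Only the values at heights 1 and 2 matter; elsewhere they are
    placeholders.\<close>
  let ?F = "\<lambda>x. if sum x {1..n} = 1 then end_map \<sigma> 1 x else end_map \<tau> 2 x"
  show ?case
  proof (intro exI[of _ ?F] conjI allI impI)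
    fix I :: "nat set" assume "I \<subseteq> {1..n}" "card I \<le> 0"
    then have "I = {}" using finite_subset by fastforce
    then show "continuous_on (cell I) ?F" "?F \<in> cell I \<rightarrow> geom (induced C (vertices_in I))"
      by (simp_all add: cell_empty)
  qed auto
next
  case (Suc k)
  obtain F where F: "?prism k F" using Suc by (rule exE)
  note F_bot = F[THEN conjunct1, rule_format]
    and F_top = F[THEN conjunct2, THEN conjunct1, rule_format]
    and F_cells = F[THEN conjunct2, THEN conjunct2, rule_format]
  note F_cont = F_cells[THEN conjunct1] and F_maps = F_cells[THEN conjunct2]
  let ?ext = "\<lambda>I g. continuous_on (cell I) g \<and> g \<in> cell I \<rightarrow> geom (induced C (vertices_in I)) \<and>
    (\<forall>x\<in>cell_boundary I. g x = F x)"
  have ext: "\<exists>g. ?ext I g" if I: "I \<subseteq> {1..n}" and card_I: "card I = Suc k" for I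
  proof (rule cell_extend)
    show fin: "finite I" using I finite_subset by blast
    show "I \<noteq> {}" using card_I by auto
    then show "htpy_conn_at (induced C (vertices_in I)) (int (card I) - 1)" using conn I by blast
    have sub: "I - {i} \<subseteq> {1..n}" "card (I - {i}) \<le> k" if "i \<in> I" for i
      using that I card_I fin by auto
    have closed_level: "closed (cell I \<inter> {x. sum x {1..n} = c})" for c :: real
    proof -
      have "continuous_on UNIV (\<lambda>x :: nat \<Rightarrow> real. sum x {1..n})"
        by (intro continuous_on_sum continuous_on_proj)
      then have "closed {x. sum x {1..n} = c}" by (rule closed_Collect_eq[OF _ continuous_on_const])
      then show ?thesis using closed_cell by (rule closed_Int[rotated])
    qed
    have bot: "continuous_on (cell I \<inter> {x. sum x {1..n} = 1}) F"
      by (rule continuous_on_eq[OF continuous_on_end_map[of _ \<sigma> 1]]) (use F_bot in auto)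
    have top: "continuous_on (cell I \<inter> {x. sum x {1..n} = 2}) F"
      by (rule continuous_on_eq[OF continuous_on_end_map[of _ \<tau> 2]]) (use F_top in auto)
    have sides: "continuous_on (\<Union>i\<in>I. cell (I - {i})) F"
      by (rule continuous_on_closed_Union) (use fin closed_cell F_cont sub in auto)
    have "closed (\<Union>i\<in>I. cell (I - {i}))" using fin closed_cell by blast
    with bot top sides closed_level show "continuous_on (cell_boundary I) F"
      unfolding cell_boundary_eq[OF I] by (intro continuous_on_closed_Un closed_Un)
    show "F \<in> cell_boundary I \<rightarrow> geom (induced C (vertices_in I))"
    proof
      fix x assume "x \<in> cell_boundary I"
      then consider "x \<in> cell I" "sum x {1..n} = 1" | "x \<in> cell I" "sum x {1..n} = 2"
        | i where "i \<in> I" "x \<in> cell (I - {i})"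
        unfolding cell_boundary_eq[OF I] by blast
      then show "F x \<in> geom (induced C (vertices_in I))"
      proof cases
        case 1
        then show ?thesis using F_bot end_map_in_geom[OF \<sigma> I, of x 1] sum_cell[OF I] by simp
      next
        case 2
        then show ?thesis using F_top end_map_in_geom[OF \<tau> I, of x 2] sum_cell[OF I] by simp
      next
        case 3
        then have "F x \<in> geom (induced C (vertices_in (I - {i})))" using F_maps sub by blast
        then show ?thesis using geom_mono[OF induced_vertices_in_mono[OF Diff_subset]] by blast
      qed
    qed
  qed
  define g where "g I = (SOME g. ?ext I g)" for I
  have g: "?ext I (g I)" if "I \<subseteq> {1..n}" "card I = Suc k" for I
    unfolding g_def by (rule someI_ex[OF ext[OF that]])
  \<comment> \<open>The support of \<open>x\<close> selects the only new cell that could contain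
    \<open>x\<close> off its sides. Points with other supports keep their value, which agrees with
    \<open>g\<close> on cell boundaries.\<close>
  define F' where "F' x = (let I = {i. x i \<noteq> 0} in
    if I \<subseteq> {1..n} \<and> card I = Suc k \<and> x \<in> cell I then g I x else F x)" for x
  have F'_eq: "F' x = F x" if "sum x {1..n} = 1 \<or> sum x {1..n} = 2" for x
  proof (cases "{i. x i \<noteq> 0} \<subseteq> {1..n} \<and> card {i. x i \<noteq> 0} = Suc k \<and> x \<in> cell {i. x i \<noteq> 0}")
    case True
    then have "x \<in> cell_boundary {i. x i \<noteq> 0}"
      using that sum_cell by (auto simp: cell_boundary_def)
    then have "g {i. x i \<noteq> 0} x = F x" using g True by blast
    then show ?thesis by (simp add: F'_def Let_def)
  next
    case False
    then show ?thesis by (simp only: F'_def Let_def if_False)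
  qed
  have supp_subset: "{i. x i \<noteq> 0} \<subseteq> I" if "x \<in> cell I" for x I
    using that by (auto simp: cell_def)
  have F'_low: "F' x = F x" if "I \<subseteq> {1..n}" "card I \<le> k" "x \<in> cell I" for I x
  proof -
    have "finite I" using that(1) finite_subset by blast
    then have "card {i. x i \<noteq> 0} \<le> k" using card_mono[OF _ supp_subset[OF that(3)]] that(2) by simp
    then show ?thesis by (simp add: F'_def Let_def)
  qed
  have F'_top: "F' x = g I x" if I: "I \<subseteq> {1..n}" "card I = Suc k" "x \<in> cell I" for I x
  proof (cases "{i. x i \<noteq> 0} = I")
    case True
    then show ?thesis using that by (simp add: F'_def Let_def)
  next
    case False
    then obtain i where i: "i \<in> I" "x i = 0" using supp_subset[OF I(3)] by blast
    then have bd: "x \<in> cell_boundary I" using I(3) by (auto simp: cell_boundary_def)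
    have "finite I" using I(1) finite_subset by blast
    then have "card {i. x i \<noteq> 0} < card I"
      using supp_subset[OF I(3)] False by (intro psubset_card_mono) auto
    then have "F' x = F x" using I(2) by (simp add: F'_def Let_def)
    then show ?thesis using g[OF I(1,2)] bd by simp
  qed
  show ?case
  proof (intro exI[of _ F'] conjI allI impI)
    show "F' x = end_map \<sigma> 1 x" if "sum x {1..n} = 1" for x using F'_eq F_bot that by simp
    show "F' x = end_map \<tau> 2 x" if "sum x {1..n} = 2" for x using F'_eq F_top that by simp
    fix I assume I: "I \<subseteq> {1..n}" "card I \<le> Suc k"
    show "continuous_on (cell I) F'"
    proof (cases "card I \<le> k")
      case True
      show ?thesis
        by (rule continuous_on_eq[OF F_cont[OF I(1) True]]) (use F'_low[OF I(1) True] in simp)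
    next
      case False
      then have c: "card I = Suc k" using I(2) by simp
      show ?thesis
        by (rule continuous_on_eq[of _ "g I"]) (use g[OF I(1) c] F'_top[OF I(1) c] in auto)
    qed
    show "F' \<in> cell I \<rightarrow> geom (induced C (vertices_in I))"
    proof
      fix x assume x: "x \<in> cell I"
      show "F' x \<in> geom (induced C (vertices_in I))"
      proof (cases "card I \<le> k")
        case True
        then show ?thesis using F'_low[OF I(1) True x] F_maps[OF I(1) True] x by auto
      next
        case False
        then have c: "card I = Suc k" using I(2) by simp
        then show ?thesis using g[OF I(1) c] F'_top[OF I(1) c x] x by auto
      qed
    qed
  qed
qed

text \<open>The product \<open>hit \<rho>\<close> detects which colourful simplices carry a point. Over the barycentre of the
  colour simplex exactly one of the sums over \<open>K\<close> and over its complement \<open>L\<close> is positive, so their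
  difference serves as the height coordinate of a self-map of the prism that misses the centre.\<close>

theorem RG_reachable_of_htpy_conn:
  assumes conn: "\<And>I. I \<subseteq> {1..n} \<Longrightarrow> I \<noteq> {} \<Longrightarrow> htpy_conn_at (induced C (vertices_in I)) (int (card I) - 1)"
    and \<sigma>: "colorful C n V \<sigma>" and \<tau>: "colorful C n V \<tau>"
  shows "(RG_adj C n V)\<^sup>*\<^sup>* \<sigma> \<tau>"
proof (rule ccontr)
  assume unreachable: "\<not> ?thesis"
  let ?M = "{1..n}"
  \<comment> \<open>Without colours the prism is empty, and the only colourful simplex is the empty
    one.\<close>
  have "n \<noteq> 0"
  proof
    assume "n = 0"
    then have "card \<sigma> = 0" "card \<tau> = 0" using \<sigma> \<tau> colorful_card by auto
    then have "\<sigma> = {}" "\<tau> = {}" using \<sigma> \<tau> finite_simplex by (auto simp: colorful_iff)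
    with unreachable show False by simp
  qed
  then have M: "finite ?M" "?M \<noteq> {}" by auto
  define K where "K = {\<rho>. colorful C n V \<rho> \<and> (RG_adj C n V)\<^sup>*\<^sup>* \<sigma> \<rho>}"
  define L where "L = {\<rho>. colorful C n V \<rho> \<and> \<not> (RG_adj C n V)\<^sup>*\<^sup>* \<sigma> \<rho>}"
  have "K \<union> L \<subseteq> C" by (auto simp: K_def L_def colorful_iff)
  then have fin: "finite K" "finite L" using finite_subset[OF _ finite_complex] by auto
  obtain F where F0: "(\<forall>x. sum x ?M = 1 \<longrightarrow> F x = end_map \<sigma> 1 x) \<and>
    (\<forall>x. sum x ?M = 2 \<longrightarrow> F x = end_map \<tau> 2 x) \<and>
    (\<forall>I. I \<subseteq> ?M \<longrightarrow> card I \<le> n \<longrightarrow>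
      continuous_on (cell I) F \<and> F \<in> cell I \<rightarrow> geom (induced C (vertices_in I)))"
    using prism_map[OF conn \<sigma> \<tau>] by (rule exE)
  note F_bot = F0[THEN conjunct1, rule_format]
    and F_top = F0[THEN conjunct2, THEN conjunct1, rule_format]
    and F = F0[THEN conjunct2, THEN conjunct2, rule_format]
  have F_cont: "continuous_on (cell ?M) F" using F[of ?M] by simp
  have F_maps: "F x \<in> geom (induced C (vertices_in I))" if "I \<subseteq> ?M" "x \<in> cell I" for I x
    using F[OF that(1)] card_mono[OF M(1) that(1)] that(2) by auto
  have F_coord: "continuous_on (cell ?M) (\<lambda>x. F x v)" for v
    by (rule continuous_on_product_then_coordinatewise[OF F_cont])
  \<comment> \<open>\<open>G\<close> is the composite with the colour map: on the prism, its values
    are barycentric coordinates in the colour simplex.\<close>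
  define G where "G x i = (\<Sum>v\<in>{v \<in> vertices C. col v = i}. F x v)" for x i
  define hit where "hit \<rho> x = (\<Prod>v\<in>\<rho>. F x v)" for \<rho> x
  \<comment> \<open>\<open>K\<close> counts negatively and \<open>L\<close> positively because the
    bottom end is \<open>\<sigma> \<in> K\<close> and the top end is
    \<open>\<tau> \<in> L\<close>.\<close>
  define H where "H x i = (3 / 2 + (sum (\<lambda>\<rho>. hit \<rho> x) L - sum (\<lambda>\<rho>. hit \<rho> x) K) / 2) * G x i" for x i
  have G_zero: "G x i = 0" if "I \<subseteq> ?M" "x \<in> cell I" "i \<notin> I" for x i I
    unfolding G_def
  proof (rule sum.neutral, rule ballI)
    fix v assume v: "v \<in> {v \<in> vertices C. col v = i}"
    have "{v. F x v \<noteq> 0} \<in> induced C (vertices_in I)"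
      using F_maps[OF that(1,2)] by (rule geom_support)
    then show "F x v = 0" using v that(3) by (auto simp: induced_def vertices_in_def)
  qed
  have supp: "{v. F x v \<noteq> 0} \<in> C" if "x \<in> cell ?M" for x
    using geom_support[OF F_maps[OF order_refl that]] by (simp add: induced_def)
  have nonneg: "0 \<le> F x v" if "x \<in> cell ?M" for x v
    using geom_nonneg[OF F_maps[OF order_refl that]] .
  have sum_G: "sum (G x) ?M = 1" if x: "x \<in> cell ?M" for x
  proof -
    have "sum (G x) ?M = sum (F x) (vertices C)"
      unfolding G_def by (rule sum.group) (use finite_vertices col_vertex(1) in auto)
    also have "\<dots> = sum (F x) {v. F x v \<noteq> 0}"
      by (rule sum.mono_neutral_right) (use finite_vertices simplex_subset_vertices[OF supp[OF x]] in auto)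
    also have "\<dots> = 1" using F_maps[OF order_refl x] by (simp add: geom_def)
    finally show ?thesis .
  qed
  have sum_H: "sum (H x) ?M = 3 / 2 + (sum (\<lambda>\<rho>. hit \<rho> x) L - sum (\<lambda>\<rho>. hit \<rho> x) K) / 2" if "x \<in> cell ?M" for x
    using sum_G[OF that] by (simp add: H_def flip: sum_distrib_left)
  have hit_nonneg: "0 \<le> hit \<rho> x" if "x \<in> cell ?M" for \<rho> x
    unfolding hit_def by (rule prod_nonneg) (use nonneg[OF that] in simp)
  have hit_supp: "\<rho> \<subseteq> {v. F x v \<noteq> 0}" if "colorful C n V \<rho>" "hit \<rho> x \<noteq> 0" for \<rho> x
    using that finite_simplex by (auto simp: hit_def colorful_iff)
  \<comment> \<open>On an end carried by \<open>\<rho>'\<close> only \<open>\<rho>'\<close> itself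
    can have a nonzero product, as all colourful simplices have \<open>n\<close> vertices.\<close>
  have hit_end: "\<rho> = \<rho>'" if "colorful C n V \<rho>" "colorful C n V \<rho>'" "hit \<rho> x \<noteq> 0" "F x = end_map \<rho>' c x" for \<rho> \<rho>' x c
  proof (rule card_subset_eq)
    show "finite \<rho>'" using that(2) finite_simplex by (simp add: colorful_iff)
    show "\<rho> \<subseteq> \<rho>'" using hit_supp[OF that(1,3)] that(4) by (auto simp: end_map_def split: if_splits)
    show "card \<rho> = card \<rho>'" using colorful_card that(1,2) by simp
  qed
  have "\<exists>x\<in>cell ?M. H x = center ?M"
  proof (rule cell_hits_center[OF M])
    have "continuous_on (cell ?M) (\<lambda>x. H x i)" for i
      unfolding H_def G_def hit_def
      by (intro continuous_intros F_coord) simp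
    then show "continuous_on (cell ?M) H" by (rule continuous_on_coordinatewise_then_product)
    show "H \<in> cell ?M \<rightarrow> supported ?M"
      using G_zero[OF order_refl] by (auto simp: supported_def H_def)
    fix x assume x: "x \<in> cell ?M"
    show "H x i = 0" if "i \<in> ?M" "x i = 0" for i
    proof -
      have "x \<in> cell (?M - {i})"
        unfolding cell_subset[OF M(1) Diff_subset] using x that by (auto simp: cell_def)
      then show ?thesis using G_zero[of "?M - {i}" x i] by (simp add: H_def)
    qed
    show "sum (H x) ?M \<le> 3 / 2" if "sum x ?M = 1"
    proof -
      have "hit \<rho> x = 0" if "\<rho> \<in> L" for \<rho>
        using that hit_end[OF _ \<sigma> _ F_bot[OF \<open>sum x ?M = 1\<close>]] by (auto simp: L_def)
      then show ?thesis using sum_H[OF x] sum_nonneg[of K "\<lambda>\<rho>. hit \<rho> x"] hit_nonneg[OF x] by simp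
    qed
    show "3 / 2 \<le> sum (H x) ?M" if "sum x ?M = 2"
    proof -
      have "hit \<rho> x = 0" if "\<rho> \<in> K" for \<rho>
        using that unreachable hit_end[OF _ \<tau> _ F_top[OF \<open>sum x ?M = 2\<close>]] by (auto simp: K_def)
      then show ?thesis using sum_H[OF x] sum_nonneg[of L "\<lambda>\<rho>. hit \<rho> x"] hit_nonneg[OF x] by simp
    qed
  qed
  then obtain x where x: "x \<in> cell ?M" and Hx: "H x = center ?M" by blast
  have balance: "sum (\<lambda>\<rho>. hit \<rho> x) L = sum (\<lambda>\<rho>. hit \<rho> x) K"
    using sum_H[OF x] sum_center[OF M] by (simp add: Hx)
  \<comment> \<open>The centre has no vanishing coordinate, so every colour occurs in the carrier of
    \<open>F x\<close>.\<close>
  have "\<exists>v. F x v \<noteq> 0 \<and> col v = i" if i: "i \<in> ?M" for i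
  proof (rule ccontr)
    assume "\<not> ?thesis"
    then have "G x i = 0" unfolding G_def by (intro sum.neutral) auto
    then have "center ?M i = 0" using fun_cong[OF Hx, of i] by (simp add: H_def)
    then show False using i \<open>n \<noteq> 0\<close> by (simp add: center_def)
  qed
  then obtain pick where pick: "\<And>i. i \<in> ?M \<Longrightarrow> F x (pick i) \<noteq> 0 \<and> col (pick i) = i" by metis
  define \<rho> where "\<rho> = pick ` ?M"
  have "\<rho> \<subseteq> {v. F x v \<noteq> 0}" using pick by (auto simp: \<rho>_def)
  have "bij_betw col \<rho> ?M"
    unfolding bij_betw_def inj_on_def \<rho>_def using pick by (force simp: image_image)
  moreover have "\<rho> \<in> C" using supp[OF x] \<open>\<rho> \<subseteq> _\<close> by (rule subset_simplex)
  ultimately have \<rho>: "colorful C n V \<rho>" by (simp add: colorful_iff)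
  have "hit \<rho> x \<noteq> 0"
    using \<open>\<rho> \<subseteq> _\<close> by (auto simp: hit_def \<rho>_def)
  then have hit_\<rho>: "hit \<rho> x > 0" using hit_nonneg[OF x, of \<rho>] by simp
  \<comment> \<open>One of the two equal sums contains the positive term of \<open>\<rho>\<close>,
    so both are positive. Simplices from \<open>K\<close> and from \<open>L\<close> then lie in the
    common carrier of \<open>F x\<close>, within which colourful simplices are connected.\<close>
  have ex_L: "\<exists>\<rho>\<in>L. hit \<rho> x \<noteq> 0" and ex_K: "\<exists>\<rho>\<in>K. hit \<rho> x \<noteq> 0"
  proof -
    have pos: "0 < sum (\<lambda>\<rho>. hit \<rho> x) A" if "finite A" "\<rho> \<in> A" for A
      by (rule sum_pos2[OF that]) (use hit_\<rho> hit_nonneg[OF x] in auto)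
    have "\<rho> \<in> K \<or> \<rho> \<in> L" using \<rho> by (simp add: K_def L_def)
    then have sums: "0 < sum (\<lambda>\<rho>. hit \<rho> x) L" "0 < sum (\<lambda>\<rho>. hit \<rho> x) K"
      using pos[OF fin(1)] pos[OF fin(2)] balance by auto
    have "\<exists>\<rho>\<in>A. hit \<rho> x \<noteq> 0" if "0 < sum (\<lambda>\<rho>. hit \<rho> x) A" for A
    proof (rule ccontr)
      assume "\<not> ?thesis"
      then have "sum (\<lambda>\<rho>. hit \<rho> x) A = 0" by (intro sum.neutral) blast
      with that show False by simp
    qed
    from this[OF sums(1)] this[OF sums(2)]
    show "\<exists>\<rho>\<in>L. hit \<rho> x \<noteq> 0" "\<exists>\<rho>\<in>K. hit \<rho> x \<noteq> 0" .
  qed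
  then obtain \<rho>\<^sub>1 \<rho>\<^sub>2 where "\<rho>\<^sub>1 \<in> K" "hit \<rho>\<^sub>1 x \<noteq> 0" "\<rho>\<^sub>2 \<in> L" "hit \<rho>\<^sub>2 x \<noteq> 0" by blast
  then have r: "colorful C n V \<rho>\<^sub>1" "colorful C n V \<rho>\<^sub>2" "(RG_adj C n V)\<^sup>*\<^sup>* \<sigma> \<rho>\<^sub>1" "\<not> (RG_adj C n V)\<^sup>*\<^sup>* \<sigma> \<rho>\<^sub>2"
    and s: "\<rho>\<^sub>1 \<union> \<rho>\<^sub>2 \<subseteq> {v. F x v \<noteq> 0}"
    using hit_supp by (auto simp: K_def L_def)
  have "\<rho>\<^sub>1 \<union> \<rho>\<^sub>2 \<in> C" using supp[OF x] s by (rule subset_simplex)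
  then have "(RG_adj C n V)\<^sup>*\<^sup>* \<rho>\<^sub>1 \<rho>\<^sub>2" by (rule RG_reachable_in_simplex[OF r(1,2)])
  with r(3,4) show False using rtranclp_trans by metis
qed

end

section \<open>Reconfiguration graphs\<close>

text \<open>\<open>eta_pi\<close> is the least \<open>d\<close> at which connectivity in degree
  \<open>d - 1\<close> fails. For \<open>d = card I\<close> this degree is the dimension of the
  sphere bounding \<open>cell I\<close>.\<close>

lemma htpy_conn_at_of_eta_pi:
  assumes "enat (d + 1) \<le> eta_pi K" shows "htpy_conn_at K (int d - 1)"
proof (rule ccontr)
  assume not: "\<not> ?thesis"
  then have "eta_pi K = enat (LEAST d. \<not> htpy_conn_at K (int d - 1))"
    by (auto simp: eta_pi_def)
  moreover have "(LEAST d. \<not> htpy_conn_at K (int d - 1)) \<le> d" using not by (rule Least_le)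
  ultimately show False using assms by simp
qed

text \<open>The index \<open>d\<close> counts vertices. For \<open>d = card I\<close> the vanishing
  concerns the faces that carry the ends and sides of the prism over \<open>I\<close>.\<close>

lemma hom_vanish_of_eta_H:
  assumes "enat (d + 1) \<le> eta_H K" shows "hom_vanish K d"
proof (rule ccontr)
  assume not: "\<not> ?thesis"
  then have "eta_H K = enat (LEAST d. \<not> hom_vanish K d)"
    by (auto simp: eta_H_def)
  moreover have "(LEAST d. \<not> hom_vanish K d) \<le> d" using not by (rule Least_le)
  ultimately show False using assms by simp
qed

theorem theorem2p2:
  fixes C :: "'v::linorder set set" and n :: nat and V :: "nat \<Rightarrow> 'v set"
    and \<eta> :: "'v set set \<Rightarrow> enat"
  assumes "simplicial_complex C"
    and "is_partition (vertices C) n V"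
    and "\<eta> \<in> {eta_pi, eta_H}"
    and "\<forall>I. I \<subseteq> {1..n} \<and> I \<noteq> {} \<longrightarrow>
           \<eta> (induced C (\<Union>i\<in>I. V i)) \<ge> enat (card I + 1)"
  shows "RG_connected C n V"
proof -
  interpret ordered_partitioned_complex C n V by unfold_locales (fact assms(1,2))+
  have \<eta>: "enat (card I + 1) \<le> \<eta> (induced C (vertices_in I))" if "I \<subseteq> {1..n}" "I \<noteq> {}" for I
    using assms(4)[rule_format, of I] that Union_classes[OF that(1)] by simp
  have "(RG_adj C n V)\<^sup>*\<^sup>* \<sigma> \<tau>" if \<sigma>\<tau>: "colorful C n V \<sigma>" "colorful C n V \<tau>" for \<sigma> \<tau>
  proof (cases "\<eta> = eta_pi")
    case True
    show ?thesis
      by (rule RG_reachable_of_htpy_conn[OF htpy_conn_at_of_eta_pi \<sigma>\<tau>]) (use \<eta> True in simp)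
  next
    case False
    then have "\<eta> = eta_H" using assms(3) by simp
    show ?thesis
      by (rule RG_reachable_of_hom_vanish[OF hom_vanish_of_eta_H \<sigma>\<tau>]) (use \<eta> \<open>\<eta> = eta_H\<close> in simp)
  qed
  then show ?thesis by (simp add: RG_connected_def)
qed

end
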